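(* Let $(\mathcal Z,\mathcal I,\lambda,\tau)$ be the twistor space of a tree-level q-map space $(\overline N,g_{\overline N})$ of dimension $4n+4$, $n\ge1$, and lift the $L$-action on $\overline N$ to $\mathcal Z\cong\overline N\times\mathbb CP^1$ by letting $L$ act trivially on the $\mathbb CP^1$ fiber. Then the lift of the $L$-action to $\mathcal Z$ is holomorphic, preserves the contact distribution and commutes with the real structure. Furthermore, it acts on the holomorphic Darboux coordinates $(\xi^i,\widetilde\xi_i,\alpha)$ with the same transformation rules as $(\zeta^i,\widetilde\zeta_i,\sigma)$ under the correspondence $\zeta^i\leftrightarrow\xi^i$, $\widetilde\zeta_i\leftrightarrow\widetilde\xi_i$, $\sigma\leftrightarrow\alpha$.
   Context: Conventions: indices $a,b,c,\dots$ run from $1$ to $n$, indices $i,j,k,\dots$ from $0$ to $n$ (an $i$ in front of $\tau_2$, or multiplying a complex quantity, is $\sqrt{-1}$); repeated indices are summed. $\langle v,w\rangle=v_iw^i-v^iw_i$ for $v=(v_i,v^i)$, $w=(w_i,w^i)$; $\zeta=(\widetilde\zeta_i,\zeta^i)$. PSR manifold: let $h(t)=\frac16 k_{abc}t^at^bt^c$ ($k_{abc}\in\mathbb R$ symmetric) be a homogeneous cubic polynomial on $\mathbb R^n$. A projective special real (PSR) manifold is a hypersurface $\mathcal H\subset\{h=1\}$ such that $-\partial^2h|_{T\mathcal H\times T\mathcal H}$ is a Riemannian metric. Tree-level q-map space: put $U=\mathbb R_{>0}\cdot\mathcal H\subset\mathbb R^n$, $\overline M=\mathbb R^n+iU\subset\mathbb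 C^n$ with coordinates $z^a=b^a+it^a$, $z^0:=1$, $K=8h(t)$ with $t=(t^a)$, $\mathcal K=-\log K$, $g_{\overline M}=\frac{\partial^2\mathcal K}{\partial z^a\partial\overline z^b}dz^ad\overline z^b$. Let $\mathfrak F(X)=-h(X^1,\dots,X^n)/X^0$, $F_i=\partial_{X^i}\mathfrak F(1,z)$, $\widetilde Z=(F_i,z^i)$, $\tau_{ij}=\partial_{X^i}\partial_{X^j}\mathfrak F(1,z)$, $N_{ij}=-2\,\mathrm{Im}\,\tau_{ij}$, $W_i=d\widetilde\zeta_i-\tau_{ij}d\zeta^j$. Then $\overline N=\overline M\times\mathbb R_{>0}\times\mathbb R^{2n+2}\times\mathbb R$ with coordinates $(z^a,\rho,\widetilde\zeta_i,\zeta^i,\sigma)$ and $g_{\overline N}=g_{\overline M}+\frac{d\rho^2}{4\rho^2}-\frac1{4\rho}(N^{ij}-\frac2Kz^i\overline z^j)W_i\overline W_j+\frac1{64\rho^2}(d\sigma+\widetilde\zeta_id\zeta^i-\zeta^id\widetilde\zeta_i)^2$. Put $\tau_2:=\sqrt{2\rho/h(t^a)}$. $L$-action: $L=L_1\ltimes L_2$ is the group of isometries of $\overline N$ generated by the following. $L_2=\mathrm{Iwa}(\mathrm{SU}(1,n+2))$ consists of $(r,\widetilde\eta_i,\eta^i,\kappa)\in\mathbb R_{>0}\times\mathbb R^{2n+3}$ acting by $z^a\mapsto z^a$, $\rho\mapsto r\rho$, $\widetilde\zeta_i\mapsto\widetilde\eta_i+\sqrt r\widetilde\zeta_i$, $\zeta^i\mapsto\eta^i+\sqrt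 r\zeta^i$, $\sigma\mapsto\kappa+r\sigma+\sqrt r(\eta^i\widetilde\zeta_i-\widetilde\eta_i\zeta^i)$. $L_1=\mathbb R_{>0}\ltimes\mathbb R^n$ acts by $\lambda\in\mathbb R_{>0}$: $(z^a,\rho,\zeta^0,\zeta^a,\widetilde\zeta_0,\widetilde\zeta_a,\sigma)\mapsto(\lambda z^a,\rho,\lambda^{-3/2}\zeta^0,\lambda^{-1/2}\zeta^a,\lambda^{3/2}\widetilde\zeta_0,\lambda^{1/2}\widetilde\zeta_a,\sigma)$, and by $v\in\mathbb R^n$: $z^a\mapsto z^a+v^a$, $\zeta^a\mapsto\zeta^a+\zeta^0v^a$, $\widetilde\zeta_0\mapsto\widetilde\zeta_0+\frac16k_{abc}v^av^bv^c\zeta^0+\frac12k_{abc}v^av^b\zeta^c-\widetilde\zeta_av^a$, $\widetilde\zeta_a\mapsto\widetilde\zeta_a-\frac12\zeta^0k_{abc}v^bv^c-k_{abc}v^b\zeta^c$, with $\rho,\zeta^0,\sigma$ fixed. Twistor space (via the HK/QK correspondence). Let $M=\{(Z^0,\dots,Z^n)=Z^0\cdot(1,z)\mid Z^0\in\mathbb C^\times,z\in\overline M\}$ with $g_M=-\mathrm{Im}(\partial_i\partial_j\mathfrak F)dZ^id\overline Z^j$, complex structure $J$, Euler field $\xi_M$, $r^2=g_M(\xi_M,\xi_M)>0$, $\widetilde\eta=r^{-2}g_M(J\xi_M,\cdot)$. Let $P=M\times\mathbb R^{2n+2}\times\mathbb R$ with coordinates $(Z^i,\widetilde\zeta_i',\zeta'^i,\sigma')$,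 $\zeta'=(\widetilde\zeta_i',\zeta'^i)$, and let $Z'=(-\partial_{Z^i}\mathfrak F(Z),Z^i)$, $f=2\pi r^2$, $\theta_+^P=-\langle Z',d\zeta'\rangle$, $\theta_-^P=-\langle\overline{Z'},d\zeta'\rangle$, $\theta_3^P=d\sigma'-\frac1{4\pi}\langle\zeta',d\zeta'\rangle+\pi r^2\widetilde\eta$. Let $V_3=2(iZ^i\partial_{Z^i}-i\overline Z^i\partial_{\overline Z^i})$. On $\widetilde N=\mathbb H^\times\times P$ with complex coordinates $z=q_0+iq_3$, $w=q_1+iq_2$ on $\mathbb H^\times\ni q_0+q_1i+q_2j+q_3k$, put $V_3^L=iz\partial_z-i\overline z\partial_{\overline z}-iw\partial_w+i\overline w\partial_{\overline w}-V_3$ and $$\widetilde\lambda=\tfrac\pi4\big(f(z\,dw-w\,dz)+z^2\theta_+^P+w^2\theta_-^P-2izw\,\theta_3^P\big).$$ $\hat N$ is the space of integral curves of $V_3^L$; $\widetilde\lambda$ descends to a $1$-form $\hat\lambda$ on $\hat N$. $\hat N$ is the HK cone (Swann bundle) of $\overline N$; $d\hat\lambda$ is (a constant multiple of) its holomorphic symplectic form for the complex structure $\hat I_3$, so that $\hat I_3$ is the complex structure whose $(0,1)$-space is the kernel of $d\hat\lambda$. The $\mathbb C^\times$-action $(z,w)\mapsto(xz,xw)$ descends to an $\hat I_3$-holomorphic action on $\hat N$ and $(\mathcal Z,\mathcal I)=(\hat N,\hat I_3)/\mathbb C^\times$; $\lambda$ is the $1$-form on $\mathcal Z$ induced by $\hat\lambda$,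 with values in the line bundle $\mathcal L=\hat N\times_{\mathbb C^\times}\mathbb C$ (action $x\cdot y=x^2y$), and the contact distribution is $\ker\lambda$. Identification $\mathcal Z\cong\overline N\times\mathbb CP^1$: represent points by points of $\widetilde N$ with $\mathrm{Arg}(Z^0)=0$; the $\mathbb CP^1$-coordinate is $t:=w/z$ and the point of $\overline N$ is given by $z^a=Z^a/Z^0$, $\rho=\frac\pi4f$, $\sigma=4\pi\sigma'$, $\zeta^i=-\zeta'^i$, $\widetilde\zeta_i=\widetilde\zeta_i'$. The real structure $\tau$ is $(p,t)\mapsto(p,-1/\overline t)$. Holomorphic Darboux coordinates on $\overline N\times(\mathbb CP^1-\{0,\infty\})$ (with $t$ the $\mathbb CP^1$-coordinate): $\xi^i=\zeta^i-\frac{i\tau_2}2(t^{-1}z^i+t\overline z^i)$, $\widetilde\xi_i=\widetilde\zeta_i-\frac{i\tau_2}2(t^{-1}F_i+t\overline F_i)$, $\alpha=\sigma-\frac{i\tau_2}2(t^{-1}\langle\widetilde Z,\zeta\rangle+t\langle\overline{\widetilde Z},\zeta\rangle)$. *)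

theory Defs
  imports "HOL-Analysis.Analysis"
begin

text \<open>
  Conventions. The index range \<open>1..n\<close> is a finite type \<^typ>\<open>'n\<close> and \<open>0..n\<close> is
  \<^typ>\<open>'n option\<close>, with \<^const>\<open>None\<close> for the index \<open>0\<close>. All spaces below are subsets of
  Euclidean spaces (or quotients of such), so tangent vectors are elements of these Euclidean spaces.
  A symmetric product \<open>A dz dw\<^sup>*\<close> of complex covectors with Hermitian coefficients denotes the real
  symmetric bilinear form \<open>(u, v) \<mapsto> Re (A dz(u) cnj (dw(v)))\<close>.
\<close>

section \<open>Projective special real manifolds and tree-level q-map spaces\<close>

definition cubic :: "('n \<Rightarrow> 'n \<Rightarrow> 'n \<Rightarrow> real) \<Rightarrow> 'a::real_normed_field^'n \<Rightarrow> 'a"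
  where "cubic k t = (\<Sum>a\<in>UNIV. \<Sum>b\<in>UNIV. \<Sum>c\<in>UNIV. of_real (k a b c) * t$a * t$b * t$c) / 6"

definition symmetric_coeffs :: "('n \<Rightarrow> 'n \<Rightarrow> 'n \<Rightarrow> real) \<Rightarrow> bool"
  where "symmetric_coeffs k \<longleftrightarrow> (\<forall>a b c. k a b c = k b a c \<and> k a b c = k a c b)"

definition hessian :: "('a::real_normed_vector \<Rightarrow> real) \<Rightarrow> 'a \<Rightarrow> 'a \<Rightarrow> 'a \<Rightarrow> real"
  where "hessian f x u v =
    frechet_derivative (\<lambda>y. frechet_derivative f (at y) v) (at x) u"

text \<open>
  By Euler's relation \<open>dh(t) t = 3 h(t)\<close>, the level set \<open>{h = 1}\<close> is itself a smooth hypersurface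
  with tangent spaces \<open>ker dh\<close>; hence the hypersurfaces contained in it are its relatively open
  subsets.
\<close>

definition psr_manifold :: "('n \<Rightarrow> 'n \<Rightarrow> 'n \<Rightarrow> real) \<Rightarrow> (real^'n) set \<Rightarrow> bool"
  where "psr_manifold k H \<longleftrightarrow>
    symmetric_coeffs k \<and>
    openin (top_of_set {t. cubic k t = 1}) H \<and>
    (\<forall>t\<in>H. \<forall>v. frechet_derivative (cubic k) (at t) v = 0 \<and> v \<noteq> 0 \<longrightarrow>
       - hessian (cubic k) t v v > 0)"

definition psr_cone :: "(real^'n) set \<Rightarrow> (real^'n) set"
  where "psr_cone H = {r *\<^sub>R t | r t. r > 0 \<and> t \<in> H}"

definition Im_vec :: "complex^'n \<Rightarrow> real^'n"
  where "Im_vec z = (\<chi> a. Im (z$a))"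

definition M_bar :: "(real^'n) set \<Rightarrow> (complex^'n) set"
  where "M_bar H = {z. Im_vec z \<in> psr_cone H}"

text \<open>The vector \<open>(z\<^sup>0, z\<^sup>a)\<close> with \<open>z\<^sup>0 = 1\<close>.\<close>

definition hom :: "complex^'n \<Rightarrow> complex^('n::finite option)"
  where "hom z = (\<chi> i. case i of None \<Rightarrow> 1 | Some a \<Rightarrow> z$a)"

definition affine_part :: "complex^('n::finite option) \<Rightarrow> complex^'n"
  where "affine_part X = (\<chi> a. X$(Some a))"

definition prepotential ::
    "('n \<Rightarrow> 'n \<Rightarrow> 'n \<Rightarrow> real) \<Rightarrow> complex^('n::finite option) \<Rightarrow> complex"
  where "prepotential k X = - cubic k (affine_part X) / X$None"

text \<open>Holomorphic partial derivative \<open>\<partial>G/\<partial>X\<^sup>i\<close>.\<close>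

definition cpartial :: "'m \<Rightarrow> (complex^'m::finite \<Rightarrow> complex) \<Rightarrow> complex^'m \<Rightarrow> complex"
  where "cpartial i G X = deriv (\<lambda>s. G (X + axis i s)) 0"

definition grad_F ::
    "('n \<Rightarrow> 'n \<Rightarrow> 'n \<Rightarrow> real) \<Rightarrow> complex^('n::finite option) \<Rightarrow> complex^('n option)"
  where "grad_F k X = (\<chi> i. cpartial i (prepotential k) X)"

definition hess_F ::
    "('n \<Rightarrow> 'n \<Rightarrow> 'n \<Rightarrow> real) \<Rightarrow> complex^('n::finite option) \<Rightarrow> complex^('n option)^('n option)"
  where "hess_F k X = (\<chi> i j. cpartial i (cpartial j (prepotential k)) X)"

definition symp :: "('a::comm_ring^'m) \<times> ('a^'m) \<Rightarrow> ('a^'m) \<times> ('a^'m) \<Rightarrow> 'a"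
  where "symp v w = (\<Sum>i\<in>UNIV. fst v $ i * snd w $ i - snd v $ i * fst w $ i)"

definition cvec :: "real^'m \<Rightarrow> complex^'m"
  where "cvec x = (\<chi> i. of_real (x$i))"

definition cnj_vec :: "complex^'m \<Rightarrow> complex^'m"
  where "cnj_vec x = (\<chi> i. cnj (x$i))"

text \<open>
  Triples \<open>(\<zeta>t\<^sub>i, \<zeta>\<^sup>i, \<sigma>)\<close>. The scalars are real for the coordinates on the q-map space, and complex
  for the holomorphic Darboux coordinates.
\<close>

type_synonym ('a, 'n) fibre = "('a^('n option)) \<times> ('a^('n option)) \<times> 'a"

text \<open>Points \<open>(z\<^sup>a, \<rho>, \<zeta>t\<^sub>i, \<zeta>\<^sup>i, \<sigma>)\<close>.\<close>

type_synonym 'n q_point = "(complex^'n) \<times> real \<times> (real, 'n) fibre"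

definition N_bar :: "(real^'n::finite) set \<Rightarrow> 'n q_point set"
  where "N_bar H = {(z, \<rho>, \<zeta>). z \<in> M_bar H \<and> \<rho> > 0}"

definition K_fun :: "('n \<Rightarrow> 'n \<Rightarrow> 'n \<Rightarrow> real) \<Rightarrow> complex^'n \<Rightarrow> real"
  where "K_fun k z = 8 * cubic k (Im_vec z)"

text \<open>Wirtinger derivatives \<open>\<partial>/\<partial>z\<^sup>a\<close> and \<open>\<partial>/\<partial>cnj(z\<^sup>a)\<close>.\<close>

definition dz :: "'n \<Rightarrow> (complex^'n \<Rightarrow> complex) \<Rightarrow> complex^'n \<Rightarrow> complex"
  where "dz a f z =
    (frechet_derivative f (at z) (axis a 1) - \<i> * frechet_derivative f (at z) (axis a \<i>)) / 2"

definition dz_bar :: "'n \<Rightarrow> (complex^'n \<Rightarrow> complex) \<Rightarrow> complex^'n \<Rightarrow> complex"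
  where "dz_bar a f z =
    (frechet_derivative f (at z) (axis a 1) + \<i> * frechet_derivative f (at z) (axis a \<i>)) / 2"

definition M_bar_metric ::
    "('n \<Rightarrow> 'n \<Rightarrow> 'n \<Rightarrow> real) \<Rightarrow> complex^'n \<Rightarrow> complex^'n \<Rightarrow> complex^'n \<Rightarrow> real"
  where "M_bar_metric k z u v =
    Re (\<Sum>a\<in>UNIV. \<Sum>b\<in>UNIV.
      dz a (dz_bar b (\<lambda>y. of_real (- ln (K_fun k y)))) z * u$a * cnj (v$b))"

definition tau :: "('n \<Rightarrow> 'n \<Rightarrow> 'n \<Rightarrow> real) \<Rightarrow> complex^'n \<Rightarrow> complex^('n::finite option)^('n option)"
  where "tau k z = hess_F k (hom z)"

definition N_mat :: "('n \<Rightarrow> 'n \<Rightarrow> 'n \<Rightarrow> real) \<Rightarrow> complex^'n \<Rightarrow> real^('n::finite option)^('n option)"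
  where "N_mat k z = (\<chi> i j. -2 * Im (tau k z $ i $ j))"

definition W_form ::
    "('n \<Rightarrow> 'n \<Rightarrow> 'n \<Rightarrow> real) \<Rightarrow> complex^'n \<Rightarrow> (real, 'n) fibre \<Rightarrow> complex^('n::finite option)"
  where "W_form k z = (\<lambda>(d\<zeta>t, d\<zeta>, d\<sigma>). cvec d\<zeta>t - tau k z *v cvec d\<zeta>)"

definition heis_form :: "(real, 'n::finite) fibre \<Rightarrow> (real, 'n) fibre \<Rightarrow> real"
  where "heis_form = (\<lambda>(\<zeta>t, \<zeta>, \<sigma>) (d\<zeta>t, d\<zeta>, d\<sigma>). d\<sigma> + symp (\<zeta>t, \<zeta>) (d\<zeta>t, d\<zeta>))"

definition q_map_metric ::
    "('n \<Rightarrow> 'n \<Rightarrow> 'n \<Rightarrow> real) \<Rightarrow> 'n::finite q_point \<Rightarrow> 'n q_point \<Rightarrow> 'n q_point \<Rightarrow> real"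
  where "q_map_metric k = (\<lambda>(z, \<rho>, \<zeta>) (u, d\<rho>, d\<zeta>) (u', d\<rho>', d\<zeta>').
    M_bar_metric k z u u'
    + d\<rho> * d\<rho>' / (4 * \<rho>\<^sup>2)
    - Re (\<Sum>i\<in>UNIV. \<Sum>j\<in>UNIV.
        (of_real (matrix_inv (N_mat k z) $ i $ j)
          - 2 / of_real (K_fun k z) * hom z $ i * cnj (hom z $ j))
        * W_form k z d\<zeta> $ i * cnj (W_form k z d\<zeta>' $ j)) / (4 * \<rho>)
    + heis_form \<zeta> d\<zeta> * heis_form \<zeta> d\<zeta>' / (64 * \<rho>\<^sup>2))"

definition tree_level_q_map_space ::
    "('n \<Rightarrow> 'n \<Rightarrow> 'n \<Rightarrow> real) \<Rightarrow> (real^'n::finite) set \<Rightarrow> 'n q_point set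
      \<Rightarrow> ('n q_point \<Rightarrow> 'n q_point \<Rightarrow> 'n q_point \<Rightarrow> real) \<Rightarrow> bool"
  where "tree_level_q_map_space k H N g \<longleftrightarrow>
    psr_manifold k H \<and> N = N_bar H \<and> (\<forall>p\<in>N. g p = q_map_metric k p)"


section \<open>The action of L\<close>

text \<open>
  \<open>Heis r \<eta>t \<eta> \<kappa>\<close> are the elements of \<open>L\<^sub>2 = Iwa(SU(1,n+2))\<close>; \<open>Dil \<lambda>\<close> and \<open>Shift v\<close> are the elements
  of the two factors of \<open>L\<^sub>1\<close>.
\<close>

datatype ('n::finite) L_gen =
    Heis real "real^('n option)" "real^('n option)" real
  | Dil real
  | Shift "real^'n"

fun valid_gen :: "'n::finite L_gen \<Rightarrow> bool"
  where
    "valid_gen (Heis r \<eta>t \<eta> \<kappa>) \<longleftrightarrow> r > 0"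
  | "valid_gen (Dil l) \<longleftrightarrow> l > 0"
  | "valid_gen (Shift v) \<longleftrightarrow> True"

fun base_rule :: "'n::finite L_gen \<Rightarrow> complex^'n \<Rightarrow> complex^'n"
  where
    "base_rule (Heis r \<eta>t \<eta> \<kappa>) z = z"
  | "base_rule (Dil l) z = l *\<^sub>R z"
  | "base_rule (Shift v) z = z + cvec v"

fun rho_rule :: "'n::finite L_gen \<Rightarrow> real \<Rightarrow> real"
  where
    "rho_rule (Heis r \<eta>t \<eta> \<kappa>) \<rho> = r * \<rho>"
  | "rho_rule (Dil l) \<rho> = \<rho>"
  | "rho_rule (Shift v) \<rho> = \<rho>"

text \<open>
  The transformation rules of \<open>(\<zeta>t\<^sub>i, \<zeta>\<^sup>i, \<sigma>)\<close>, as formulas that make sense for real as well as for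
  complex arguments.
\<close>

fun fibre_rule ::
    "('n \<Rightarrow> 'n \<Rightarrow> 'n \<Rightarrow> real) \<Rightarrow> 'n::finite L_gen
      \<Rightarrow> ('a::real_normed_field, 'n) fibre \<Rightarrow> ('a, 'n) fibre"
  where
    "fibre_rule k (Heis r \<eta>t \<eta> \<kappa>) (\<zeta>t, \<zeta>, \<sigma>) =
      ((\<chi> i. of_real (\<eta>t$i) + of_real (sqrt r) * \<zeta>t$i),
       (\<chi> i. of_real (\<eta>$i) + of_real (sqrt r) * \<zeta>$i),
       of_real \<kappa> + of_real r * \<sigma>
         + of_real (sqrt r) * (\<Sum>i\<in>UNIV. of_real (\<eta>$i) * \<zeta>t$i - of_real (\<eta>t$i) * \<zeta>$i))"
  | "fibre_rule k (Dil l) (\<zeta>t, \<zeta>, \<sigma>) =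
      ((\<chi> i. case i of None \<Rightarrow> of_real (l powr (3/2)) * \<zeta>t$None
                     | Some a \<Rightarrow> of_real (l powr (1/2)) * \<zeta>t$(Some a)),
       (\<chi> i. case i of None \<Rightarrow> of_real (l powr (-3/2)) * \<zeta>$None
                     | Some a \<Rightarrow> of_real (l powr (-1/2)) * \<zeta>$(Some a)),
       \<sigma>)"
  | "fibre_rule k (Shift v) (\<zeta>t, \<zeta>, \<sigma>) =
      ((\<chi> i. case i of
          None \<Rightarrow> \<zeta>t$None
            + (\<Sum>a\<in>UNIV. \<Sum>b\<in>UNIV. \<Sum>c\<in>UNIV. of_real (k a b c * v$a * v$b * v$c)) / 6 * \<zeta>$None
            + (\<Sum>a\<in>UNIV. \<Sum>b\<in>UNIV. \<Sum>c\<in>UNIV. of_real (k a b c * v$a * v$b) * \<zeta>$(Some c)) / 2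
            - (\<Sum>a\<in>UNIV. \<zeta>t$(Some a) * of_real (v$a))
        | Some a \<Rightarrow> \<zeta>t$(Some a)
            - \<zeta>$None * (\<Sum>b\<in>UNIV. \<Sum>c\<in>UNIV. of_real (k a b c * v$b * v$c)) / 2
            - (\<Sum>b\<in>UNIV. \<Sum>c\<in>UNIV. of_real (k a b c * v$b) * \<zeta>$(Some c))),
       (\<chi> i. case i of None \<Rightarrow> \<zeta>$None | Some a \<Rightarrow> \<zeta>$(Some a) + \<zeta>$None * of_real (v$a)),
       \<sigma>)"

definition gen_act ::
    "('n \<Rightarrow> 'n \<Rightarrow> 'n \<Rightarrow> real) \<Rightarrow> 'n::finite L_gen \<Rightarrow> 'n q_point \<Rightarrow> 'n q_point"
  where "gen_act k g = (\<lambda>(z, \<rho>, \<zeta>). (base_rule g z, rho_rule g \<rho>, fibre_rule k g \<zeta>))"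

definition L_words :: "'n::finite L_gen list set"
  where "L_words = lists {g. valid_gen g}"

fun word_act ::
    "('n \<Rightarrow> 'n \<Rightarrow> 'n \<Rightarrow> real) \<Rightarrow> 'n::finite L_gen list \<Rightarrow> 'n q_point \<Rightarrow> 'n q_point"
  where
    "word_act k [] = id"
  | "word_act k (g # w) = gen_act k g \<circ> word_act k w"

fun word_rule ::
    "('n \<Rightarrow> 'n \<Rightarrow> 'n \<Rightarrow> real) \<Rightarrow> 'n::finite L_gen list
      \<Rightarrow> ('a::real_normed_field, 'n) fibre \<Rightarrow> ('a, 'n) fibre"
  where
    "word_rule k [] = id"
  | "word_rule k (g # w) = fibre_rule k g \<circ> word_rule k w"

text \<open>
  The group generated by the generators. No inverses need to be adjoined, because the set of
  generators is closed under inverses; see \<open>L_group_inverse\<close> below.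
\<close>

definition L_group ::
    "('n \<Rightarrow> 'n \<Rightarrow> 'n \<Rightarrow> real) \<Rightarrow> ('n::finite q_point \<Rightarrow> 'n q_point) set"
  where "L_group k = word_act k ` L_words"

fun gen_inv :: "'n::finite L_gen \<Rightarrow> 'n L_gen"
  where
    "gen_inv (Heis r \<eta>t \<eta> \<kappa>) =
      Heis (1 / r) (- (1 / sqrt r) *\<^sub>R \<eta>t) (- (1 / sqrt r) *\<^sub>R \<eta>) (- \<kappa> / r)"
  | "gen_inv (Dil l) = Dil (1 / l)"
  | "gen_inv (Shift v) = Shift (- v)"

lemma valid_gen_inv: "valid_gen g \<Longrightarrow> valid_gen (gen_inv g)"
  by (cases g) auto

lemma gen_inv_inv: "valid_gen g \<Longrightarrow> gen_inv (gen_inv g) = g"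
  by (cases g) (auto simp: real_sqrt_divide)

lemma gen_act_inv:
  assumes "valid_gen g"
  shows "gen_act k (gen_inv g) (gen_act k g p) = p"
proof -
  obtain z \<rho> \<zeta>t \<zeta> \<sigma> where p: "p = (z, \<rho>, \<zeta>t, \<zeta>, \<sigma>)"
    by (metis prod.exhaust)
  show ?thesis
  proof (cases g)
    case (Heis r et e \<kappa>)
    then have r: "r > 0" using assms by simp
    define q where "q = sqrt r"
    have q: "q > 0" "r = q * q" using r by (auto simp: q_def)
    have *: "(\<Sum>i\<in>UNIV. - (1 / q) * e $ i * (et $ i + q * \<zeta>t $ i)
               - (- (1 / q) * et $ i * (e $ i + q * \<zeta> $ i)))
           = - (\<Sum>i\<in>UNIV. e $ i * \<zeta>t $ i - et $ i * \<zeta> $ i)"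
      unfolding sum_negf[symmetric]
      by (rule sum.cong) (use q in \<open>auto simp: field_simps\<close>)
    have "sqrt r = q" "sqrt (1 / r) = 1 / q"
      by (auto simp: q_def real_sqrt_divide)
    with * q show ?thesis
      unfolding Heis p gen_act_def
      by (simp add: vec_eq_iff) (simp add: field_simps)
  next
    case (Dil l)
    then have l: "l > 0" using assms by simp
    have "(1 / l) powr x * (l powr x * y) = y" for x y :: real
      using l by (simp add: powr_divide)
    then show ?thesis
      using l unfolding Dil p gen_act_def
      by (auto simp: vec_eq_iff split: option.splits)
  next
    case (Shift v)
    let ?S3 = "\<Sum>a\<in>UNIV. \<Sum>b\<in>UNIV. \<Sum>c\<in>UNIV. k a b c * v$a * v$b * v$c"
    let ?S2 = "\<Sum>a\<in>UNIV. \<Sum>b\<in>UNIV. \<Sum>c\<in>UNIV. k a b c * v$a * v$b * \<zeta>$(Some c)"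
    have S2: "(\<Sum>a\<in>UNIV. (\<Sum>b\<in>UNIV. \<Sum>c\<in>UNIV. k a b c * v$b * \<zeta>$(Some c)) * v$a) = ?S2"
      by (simp add: sum_distrib_left mult_ac)
    have S3: "(\<Sum>a\<in>UNIV. (\<Sum>b\<in>UNIV. \<Sum>c\<in>UNIV. k a b c * v$b * v$c) * v$a) = ?S3"
      by (simp add: sum_distrib_left mult_ac)
    have S2': "(\<Sum>a\<in>UNIV. \<Sum>b\<in>UNIV. \<Sum>c\<in>UNIV.
        k a b c * v$a * v$b * (\<zeta>$(Some c) + \<zeta>$None * v$c)) = ?S2 + \<zeta>$None * ?S3"
      by (simp add: distrib_left sum.distrib sum_distrib_left mult_ac)
    have S1': "(\<Sum>b\<in>UNIV. \<Sum>c\<in>UNIV. k a b c * v$b * (\<zeta>$(Some c) + \<zeta>$None * v$c))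
        = (\<Sum>b\<in>UNIV. \<Sum>c\<in>UNIV. k a b c * v$b * \<zeta>$(Some c))
          + \<zeta>$None * (\<Sum>b\<in>UNIV. \<Sum>c\<in>UNIV. k a b c * v$b * v$c)" for a
      by (simp add: distrib_left sum.distrib sum_distrib_left mult_ac)
    have T: "(\<Sum>a\<in>UNIV. (\<zeta>t$(Some a)
            - \<zeta>$None * (\<Sum>b\<in>UNIV. \<Sum>c\<in>UNIV. k a b c * v$b * v$c) / 2
            - (\<Sum>b\<in>UNIV. \<Sum>c\<in>UNIV. k a b c * v$b * \<zeta>$(Some c))) * v$a)
        = (\<Sum>a\<in>UNIV. \<zeta>t$(Some a) * v$a) - \<zeta>$None * ?S3 / 2 - ?S2"
      unfolding S2[symmetric] S3[symmetric]
      by (simp add: left_diff_distrib right_diff_distrib sum_subtractf sum_distrib_left sum_divide_distrib mult_ac)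
    show ?thesis
      unfolding Shift p gen_act_def
      by (simp add: vec_eq_iff cvec_def sum_negf S1' S2' T split: option.splits) (simp add: algebra_simps)
  qed
qed

lemma word_act_append: "word_act k (u @ w) = word_act k u \<circ> word_act k w"
  by (induction u) auto

lemma word_act_inv:
  assumes "w \<in> L_words"
  shows "word_act k (rev (map gen_inv w)) \<circ> word_act k w = id"
  using assms
proof (induction w)
  case (Cons g w)
  then have g: "valid_gen g" and w: "w \<in> L_words"
    by (auto simp: L_words_def)
  show ?case
    using Cons.IH[OF w] gen_act_inv[OF g]
    by (auto simp: word_act_append fun_eq_iff)
qed simp

lemma L_group_inverse:
  assumes "\<phi> \<in> L_group k"
  shows "\<exists>\<psi>\<in>L_group k. \<psi> \<circ> \<phi> = id \<and> \<phi> \<circ> \<psi> = id"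
proof -
  from assms obtain w where w: "w \<in> L_words" "\<phi> = word_act k w"
    by (auto simp: L_group_def)
  let ?w' = "rev (map gen_inv w)"
  have w': "?w' \<in> L_words"
    using w(1) by (auto simp: L_words_def in_lists_conv_set valid_gen_inv)
  have "map (\<lambda>g. gen_inv (gen_inv g)) w = map id w"
    using w(1) by (intro map_cong) (auto simp: L_words_def in_lists_conv_set gen_inv_inv)
  then have "rev (map gen_inv ?w') = w"
    by (simp add: rev_map comp_def)
  with word_act_inv[OF w(1), of k] word_act_inv[OF w', of k] w' w(2) show ?thesis
    by (auto simp: L_group_def)
qed

lemma L_group_id: "id \<in> L_group k"
  unfolding L_group_def L_words_def by (metis image_eqI lists.Nil word_act.simps(1))

lemma L_group_comp: "\<phi> \<in> L_group k \<Longrightarrow> \<psi> \<in> L_group k \<Longrightarrow> \<phi> \<circ> \<psi> \<in> L_group k"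
  unfolding L_group_def L_words_def
  by (auto simp: word_act_append[symmetric] intro!: imageI)

lemma psr_cone_scaleR: "l > 0 \<Longrightarrow> t \<in> psr_cone H \<Longrightarrow> l *\<^sub>R t \<in> psr_cone H"
  unfolding psr_cone_def by (force intro: mult_pos_pos)

lemma gen_act_N_bar:
  fixes g :: "'n::finite L_gen"
  assumes "valid_gen g" "p \<in> N_bar H"
  shows "gen_act k g p \<in> N_bar H"
proof -
  have "Im_vec (l *\<^sub>R z) = l *\<^sub>R Im_vec z" for l and z :: "complex^'n"
    by (simp add: Im_vec_def vec_eq_iff)
  moreover have "Im_vec (z + cvec v) = Im_vec z" for z and v :: "real^'n"
    by (simp add: Im_vec_def cvec_def vec_eq_iff)
  ultimately show ?thesis
    using assms by (cases g) (auto simp: gen_act_def N_bar_def M_bar_def psr_cone_scaleR)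
qed

lemma L_group_N_bar:
  assumes "\<phi> \<in> L_group k"
  shows "bij_betw \<phi> (N_bar H) (N_bar H)"
proof -
  have sub: "\<psi> p \<in> N_bar H" if "\<psi> \<in> L_group k" "p \<in> N_bar H" for \<psi> p
  proof -
    from that(1) obtain w where w: "w \<in> L_words" "\<psi> = word_act k w"
      by (auto simp: L_group_def)
    have "word_act k w p \<in> N_bar H"
      using w(1) by (induction w) (auto simp: L_words_def gen_act_N_bar that(2))
    then show ?thesis using w by simp
  qed
  from L_group_inverse[OF assms] obtain \<psi>
    where "\<psi> \<in> L_group k" "\<psi> \<circ> \<phi> = id" "\<phi> \<circ> \<psi> = id" by blast
  then show ?thesis
    using sub assms by (intro bij_betw_byWitness[where f' = \<psi>]) (auto simp: fun_eq_iff)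
qed

text \<open>The rule attached to a word is the rule by which it transforms \<open>(\<zeta>t\<^sub>i, \<zeta>\<^sup>i, \<sigma>)\<close>.\<close>

lemma word_act_fibre: "snd (snd (word_act k w p)) = word_rule k w (snd (snd p))"
  by (induction w) (auto simp: gen_act_def split: prod.splits)


section \<open>The HK/QK correspondence and the twistor space\<close>

definition M_set :: "(real^'n::finite) set \<Rightarrow> (complex^('n option)) set"
  where "M_set H = {c *s hom z | c z. c \<noteq> 0 \<and> z \<in> M_bar H}"

definition M_metric ::
    "('n \<Rightarrow> 'n \<Rightarrow> 'n \<Rightarrow> real) \<Rightarrow> complex^('n::finite option)
      \<Rightarrow> complex^('n option) \<Rightarrow> complex^('n option) \<Rightarrow> real"
  where "M_metric k Z u v =
    (\<Sum>i\<in>UNIV. \<Sum>j\<in>UNIV. - Im (hess_F k Z $ i $ j) * Re (u$i * cnj (v$j)))"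

text \<open>The Euler field \<open>\<xi>\<^sub>M\<close> at the point \<open>Z\<close> is the vector \<open>Z\<close>, and \<open>J\<close> is multiplication by \<open>\<i>\<close>.\<close>

definition r_sq :: "('n \<Rightarrow> 'n \<Rightarrow> 'n \<Rightarrow> real) \<Rightarrow> complex^('n::finite option) \<Rightarrow> real"
  where "r_sq k Z = M_metric k Z Z Z"

definition eta_form ::
    "('n \<Rightarrow> 'n \<Rightarrow> 'n \<Rightarrow> real) \<Rightarrow> complex^('n::finite option) \<Rightarrow> complex^('n option) \<Rightarrow> real"
  where "eta_form k Z u = M_metric k Z (\<i> *s Z) u / r_sq k Z"

definition f_fun :: "('n \<Rightarrow> 'n \<Rightarrow> 'n \<Rightarrow> real) \<Rightarrow> complex^('n::finite option) \<Rightarrow> real"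
  where "f_fun k Z = 2 * pi * r_sq k Z"

text \<open>
  Points \<open>((z, w), Z, \<zeta>t'\<^sub>i, \<zeta>'\<^sup>i, \<sigma>')\<close> of \<open>\<H>\<^sup>\<times> \<times> P\<close>; the quaternion \<open>q\<^sub>0 + q\<^sub>1 i + q\<^sub>2 j + q\<^sub>3 k\<close> is given by
  \<open>z = q\<^sub>0 + \<i> q\<^sub>3\<close> and \<open>w = q\<^sub>1 + \<i> q\<^sub>2\<close>.
\<close>

type_synonym 'n n_point = "(complex \<times> complex) \<times> (complex^('n option)) \<times> (real, 'n) fibre"

definition N_tilde :: "(real^'n::finite) set \<Rightarrow> 'n n_point set"
  where "N_tilde H = {((z, w), Z, \<zeta>). (z, w) \<noteq> (0, 0) \<and> Z \<in> M_set H}"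

definition theta_plus ::
    "('n \<Rightarrow> 'n \<Rightarrow> 'n \<Rightarrow> real) \<Rightarrow> complex^('n::finite option) \<Rightarrow> (real, 'n) fibre \<Rightarrow> complex"
  where "theta_plus k Z = (\<lambda>(d\<zeta>t, d\<zeta>, d\<sigma>). - symp (- grad_F k Z, Z) (cvec d\<zeta>t, cvec d\<zeta>))"

definition theta_minus ::
    "('n \<Rightarrow> 'n \<Rightarrow> 'n \<Rightarrow> real) \<Rightarrow> complex^('n::finite option) \<Rightarrow> (real, 'n) fibre \<Rightarrow> complex"
  where "theta_minus k Z = (\<lambda>(d\<zeta>t, d\<zeta>, d\<sigma>).
    - symp (cnj_vec (- grad_F k Z), cnj_vec Z) (cvec d\<zeta>t, cvec d\<zeta>))"

definition theta_3 ::
    "('n \<Rightarrow> 'n \<Rightarrow> 'n \<Rightarrow> real) \<Rightarrow> (complex^('n::finite option)) \<times> (real, 'n) fibre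
      \<Rightarrow> (complex^('n option)) \<times> (real, 'n) fibre \<Rightarrow> real"
  where "theta_3 k = (\<lambda>(Z, (\<zeta>t, \<zeta>, \<sigma>)) (dZ, (d\<zeta>t, d\<zeta>, d\<sigma>)).
    d\<sigma> - symp (\<zeta>t, \<zeta>) (d\<zeta>t, d\<zeta>) / (4 * pi) + pi * r_sq k Z * eta_form k Z dZ)"

definition lambda_tilde ::
    "('n \<Rightarrow> 'n \<Rightarrow> 'n \<Rightarrow> real) \<Rightarrow> 'n::finite n_point \<Rightarrow> 'n n_point \<Rightarrow> complex"
  where "lambda_tilde k = (\<lambda>((z, w), Z, \<zeta>) ((dz, dw), dZ, d\<zeta>).
    of_real (pi / 4) *
      (of_real (f_fun k Z) * (z * dw - w * dz)
       + z\<^sup>2 * theta_plus k Z d\<zeta> + w\<^sup>2 * theta_minus k Z d\<zeta>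
       - 2 * \<i> * z * w * of_real (theta_3 k (Z, \<zeta>) (dZ, d\<zeta>))))"

text \<open>
  Exterior derivative of a 1-form, \<open>d\<alpha>(u, v) = u(\<alpha>(v)) - v(\<alpha>(u))\<close> for constant vector fields \<open>u, v\<close>.
\<close>

definition ext_deriv ::
    "('a::real_normed_vector \<Rightarrow> 'a \<Rightarrow> 'b::real_normed_vector) \<Rightarrow> 'a \<Rightarrow> 'a \<Rightarrow> 'a \<Rightarrow> 'b"
  where "ext_deriv \<alpha> x u v =
    frechet_derivative (\<lambda>y. \<alpha> y v) (at x) u - frechet_derivative (\<lambda>y. \<alpha> y u) (at x) v"

definition V3L :: "'n::finite n_point \<Rightarrow> 'n n_point"
  where "V3L = (\<lambda>((z, w), Z, \<zeta>). ((\<i> * z, - \<i> * w), - (2 * \<i>) *s Z, 0))"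

definition integral_curve :: "(real^'n::finite) set \<Rightarrow> (real \<Rightarrow> 'n n_point) \<Rightarrow> bool"
  where "integral_curve H \<gamma> \<longleftrightarrow>
    (\<forall>s. \<gamma> s \<in> N_tilde H \<and> (\<gamma> has_vector_derivative V3L (\<gamma> s)) (at s))"

definition N_hat :: "(real^'n::finite) set \<Rightarrow> 'n n_point set set"
  where "N_hat H = {range \<gamma> | \<gamma>. integral_curve H \<gamma>}"

definition cstar_act :: "complex \<Rightarrow> 'n::finite n_point \<Rightarrow> 'n n_point"
  where "cstar_act x = (\<lambda>((z, w), P). ((x * z, x * w), P))"

text \<open>Two points of \<open>N_tilde\<close> represent the same point of the quotient of \<open>N_hat\<close> by the action
  of the nonzero complex numbers.\<close>

definition twistor_equiv :: "(real^'n::finite) set \<Rightarrow> 'n n_point \<Rightarrow> 'n n_point \<Rightarrow> bool"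
  where "twistor_equiv H p q \<longleftrightarrow> (\<exists>x C. x \<noteq> 0 \<and> C \<in> N_hat H \<and> cstar_act x p \<in> C \<and> q \<in> C)"

text \<open>The projective line with its affine coordinate \<open>t = w/z\<close>, \<open>t = Infty\<close> at \<open>z = 0\<close>.\<close>

datatype cp1 = Fin complex | Infty

type_synonym 'n z_point = "'n q_point \<times> cp1"

definition twistor_space :: "(real^'n::finite) set \<Rightarrow> 'n z_point set"
  where "twistor_space H = N_bar H \<times> UNIV"

text \<open>
  The identification of the twistor space with \<open>N_bar H \<times> \<complex>P\<^sup>1\<close>: the coordinates of the class of \<open>p\<close>
  are read off at a representative \<open>q\<close> with \<open>Arg(Z\<^sup>0) = 0\<close>.
\<close>

definition gauge_coords ::
    "('n \<Rightarrow> 'n \<Rightarrow> 'n \<Rightarrow> real) \<Rightarrow> 'n::finite n_point \<Rightarrow> 'n z_point"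
  where "gauge_coords k = (\<lambda>((z, w), Z, (\<zeta>t, \<zeta>, \<sigma>)).
    (((\<chi> a. Z$(Some a) / Z$None), pi / 4 * f_fun k Z, (\<zeta>t, - \<zeta>, 4 * pi * \<sigma>)),
     if z = 0 then Infty else Fin (w / z)))"

definition twistor_proj ::
    "('n \<Rightarrow> 'n \<Rightarrow> 'n \<Rightarrow> real) \<Rightarrow> (real^'n::finite) set \<Rightarrow> 'n n_point \<Rightarrow> 'n z_point"
  where "twistor_proj k H p =
    (THE x. \<exists>q. twistor_equiv H p q \<and> Arg (fst (snd q) $ None) = 0 \<and> x = gauge_coords k q)"

definition twistor_fibre ::
    "('n \<Rightarrow> 'n \<Rightarrow> 'n \<Rightarrow> real) \<Rightarrow> (real^'n::finite) set \<Rightarrow> 'n z_point \<Rightarrow> 'n n_point set"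
  where "twistor_fibre k H x = {p \<in> N_tilde H. twistor_proj k H p = x}"

text \<open>
  The two affine charts \<open>t\<close> and \<open>1/t\<close> of the projective line, as pairs of a domain and a map. They
  provide the charts of \<open>N_bar H \<times> \<complex>P\<^sup>1\<close>, in which tangent vectors of the twistor space are expressed.
\<close>

type_synonym cp1_chart = "cp1 set \<times> (cp1 \<Rightarrow> complex)"

fun coord_t :: "cp1 \<Rightarrow> complex"
  where "coord_t (Fin t) = t" | "coord_t Infty = 0"

fun coord_inv_t :: "cp1 \<Rightarrow> complex"
  where "coord_inv_t (Fin t) = inverse t" | "coord_inv_t Infty = 0"

definition cp1_charts :: "cp1_chart set"
  where "cp1_charts = {(- {Infty}, coord_t), (- {Fin 0}, coord_inv_t)}"

definition z_chart :: "cp1_chart \<Rightarrow> 'n::finite z_point \<Rightarrow> 'n q_point \<times> complex"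
  where "z_chart c = map_prod id (snd c)"

definition z_chart_inv :: "cp1_chart \<Rightarrow> 'n::finite q_point \<times> complex \<Rightarrow> 'n z_point"
  where "z_chart_inv c = map_prod id (inv_into (fst c) (snd c))"

text \<open>Differential at \<open>p\<close> of the projection from \<open>N_tilde\<close> onto the twistor space.\<close>

definition d_proj ::
    "('n \<Rightarrow> 'n \<Rightarrow> 'n \<Rightarrow> real) \<Rightarrow> (real^'n::finite) set \<Rightarrow> cp1_chart
      \<Rightarrow> 'n n_point \<Rightarrow> 'n n_point \<Rightarrow> 'n q_point \<times> complex"
  where "d_proj k H c p = frechet_derivative (z_chart c \<circ> twistor_proj k H) (at p)"

text \<open>
  The complex structure of the twistor space, given by its (0,1)-space at \<open>x\<close>: the image of the kernel
  of the complexified 2-form \<open>d\<lambda>~\<close>. This kernel is the preimage of the kernel of \<open>d\<lambda>^\<close> on \<open>N_hat\<close>,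
  i.e. of the (0,1)-space of \<open>I^\<^sub>3\<close>. A complexified tangent vector \<open>u + \<i> v\<close> is written as the pair
  \<open>(u, v)\<close> of its real and imaginary part.
\<close>

definition T01 ::
    "('n \<Rightarrow> 'n \<Rightarrow> 'n \<Rightarrow> real) \<Rightarrow> (real^'n::finite) set \<Rightarrow> cp1_chart \<Rightarrow> 'n z_point
      \<Rightarrow> (('n q_point \<times> complex) \<times> ('n q_point \<times> complex)) set"
  where "T01 k H c x =
    {(d_proj k H c p u, d_proj k H c p v) | p u v.
       p \<in> twistor_fibre k H x \<and>
       (\<forall>y. ext_deriv (lambda_tilde k) p u y + \<i> * ext_deriv (lambda_tilde k) p v y = 0)}"

text \<open>
  The contact form \<open>\<lambda>\<close>. An element of the line bundle \<open>\<L>\<close> over \<open>x\<close> is a class of pairs of a point over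
  \<open>x\<close> and a complex number; it is written as the set of all the pairs \<open>(p, y)\<close> representing it,
  with \<open>p \<in> N_tilde H\<close>. Since \<open>\<lambda>~\<close> is homogeneous of degree 2 under \<^const>\<open>cstar_act\<close>, the set below
  is such a class.
\<close>

definition contact_form ::
    "('n \<Rightarrow> 'n \<Rightarrow> 'n \<Rightarrow> real) \<Rightarrow> (real^'n::finite) set \<Rightarrow> cp1_chart \<Rightarrow> 'n z_point
      \<Rightarrow> 'n q_point \<times> complex \<Rightarrow> ('n n_point \<times> complex) set"
  where "contact_form k H c x v =
    {(p, lambda_tilde k p u) | p u. p \<in> twistor_fibre k H x \<and> d_proj k H c p u = v}"

definition contact_distribution ::
    "('n \<Rightarrow> 'n \<Rightarrow> 'n \<Rightarrow> real) \<Rightarrow> (real^'n::finite) set \<Rightarrow> cp1_chart \<Rightarrow> 'n z_point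
      \<Rightarrow> ('n q_point \<times> complex) set"
  where "contact_distribution k H c x =
    {v. contact_form k H c x v = twistor_fibre k H x \<times> {0}}"

text \<open>The differential of \<open>\<phi>\<close> at \<open>x\<close> in the charts \<open>c\<close> around \<open>x\<close> and \<open>c'\<close> around \<open>\<phi> x\<close> is \<open>A\<close>.\<close>

definition has_differential ::
    "('n::finite z_point \<Rightarrow> 'n z_point) \<Rightarrow> cp1_chart \<Rightarrow> cp1_chart \<Rightarrow> 'n z_point
      \<Rightarrow> ('n q_point \<times> complex \<Rightarrow> 'n q_point \<times> complex) \<Rightarrow> bool"
  where "has_differential \<phi> c c' x A \<longleftrightarrow>
    ((z_chart c' \<circ> \<phi> \<circ> z_chart_inv c) has_derivative A) (at (z_chart c x))"

definition twistor_holomorphic ::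
    "('n \<Rightarrow> 'n \<Rightarrow> 'n \<Rightarrow> real) \<Rightarrow> (real^'n::finite) set \<Rightarrow> ('n z_point \<Rightarrow> 'n z_point) \<Rightarrow> bool"
  where "twistor_holomorphic k H \<phi> \<longleftrightarrow>
    \<phi> ` twistor_space H \<subseteq> twistor_space H \<and>
    (\<forall>x\<in>twistor_space H. \<forall>c\<in>cp1_charts. \<forall>c'\<in>cp1_charts.
       snd x \<in> fst c \<longrightarrow> snd (\<phi> x) \<in> fst c' \<longrightarrow>
       (\<exists>A. has_differential \<phi> c c' x A \<and>
            (\<forall>(u, v)\<in>T01 k H c x. (A u, A v) \<in> T01 k H c' (\<phi> x))))"

definition preserves_contact_distribution ::
    "('n \<Rightarrow> 'n \<Rightarrow> 'n \<Rightarrow> real) \<Rightarrow> (real^'n::finite) set \<Rightarrow> ('n z_point \<Rightarrow> 'n z_point) \<Rightarrow> bool"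
  where "preserves_contact_distribution k H \<phi> \<longleftrightarrow>
    (\<forall>x\<in>twistor_space H. \<forall>c\<in>cp1_charts. \<forall>c'\<in>cp1_charts.
       snd x \<in> fst c \<longrightarrow> snd (\<phi> x) \<in> fst c' \<longrightarrow>
       (\<exists>A. has_differential \<phi> c c' x A \<and>
            A ` contact_distribution k H c x = contact_distribution k H c' (\<phi> x)))"

fun antipodal :: "cp1 \<Rightarrow> cp1"
  where "antipodal (Fin t) = (if t = 0 then Infty else Fin (- 1 / cnj t))" | "antipodal Infty = Fin 0"

definition real_structure :: "'n::finite z_point \<Rightarrow> 'n z_point"
  where "real_structure = map_prod id antipodal"

definition twistor_lift :: "('n::finite q_point \<Rightarrow> 'n q_point) \<Rightarrow> 'n z_point \<Rightarrow> 'n z_point"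
  where "twistor_lift \<phi> = map_prod \<phi> id"


section \<open>Holomorphic Darboux coordinates\<close>

definition tau2 :: "('n \<Rightarrow> 'n \<Rightarrow> 'n \<Rightarrow> real) \<Rightarrow> complex^'n \<Rightarrow> real \<Rightarrow> real"
  where "tau2 k z \<rho> = sqrt (2 * \<rho> / cubic k (Im_vec z))"

text \<open>The coordinates \<open>(\<xi>t\<^sub>i, \<xi>\<^sup>i, \<alpha>)\<close> away from \<open>t = 0\<close> and \<open>t = Infty\<close>.\<close>

definition darboux ::
    "('n \<Rightarrow> 'n \<Rightarrow> 'n \<Rightarrow> real) \<Rightarrow> 'n::finite z_point \<Rightarrow> (complex, 'n) fibre"
  where "darboux k = (\<lambda>((z, \<rho>, (\<zeta>t, \<zeta>, \<sigma>)), s).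
    let t = coord_t s;
        c = \<i> * of_real (tau2 k z \<rho>) / 2;
        F = grad_F k (hom z);
        Z = hom z
    in ((\<chi> i. of_real (\<zeta>t$i) - c * (inverse t * F$i + t * cnj (F$i))),
        (\<chi> i. of_real (\<zeta>$i) - c * (inverse t * Z$i + t * cnj (Z$i))),
        of_real \<sigma> - c * (inverse t * symp (F, Z) (cvec \<zeta>t, cvec \<zeta>)
                         + t * symp (cnj_vec F, cnj_vec Z) (cvec \<zeta>t, cvec \<zeta>))))"

end

theory Submission
  imports Defs
begin

text \<open>
  Every generator acts on \<open>(\<zeta>t\<^sub>i, \<zeta>\<^sup>i)\<close> by a linear map \<open>P\<close> followed by a translation, where \<open>P\<close>
  multiplies the symplectic form by a constant \<open>m\<close> and satisfies
  \<open>P (\<partial>F(Z), Z) = (\<partial>F(B Z), B Z)\<close> for a linear map \<open>B\<close> of \<open>Z\<close> with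
  \<open>Im \<partial>\<partial>F(B Z) (B u, B v) = m Im \<partial>\<partial>F(Z) (u, v)\<close>. Hence \<open>(z, w, Z, \<zeta>') \<mapsto> (z, w, B Z, P \<zeta>' + const)\<close>
  is an affine automorphism of \<open>N_tilde\<close> that covers the action, commutes with the flow of
  \<open>V\<^sub>3\<^sup>L\<close>, and pulls \<open>\<lambda>~\<close> back to \<open>m \<lambda>~\<close>. It therefore preserves the kernels of \<open>\<lambda>~\<close> and
  \<open>d\<lambda>~\<close>, provided that the projection to the twistor space is differentiable; this is seen from its
  explicit form, for which the integral curves of \<open>V\<^sub>3\<^sup>L\<close> are computed. The same identities for \<open>P\<close>
  give the transformation of the Darboux coordinates.
\<close>

section \<open>The cubic form and the derivatives of the prepotential\<close>

text \<open>The choice of B is dictated by the base. The coordinate \<rho> is a multiple of r^2 =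
  g_M(Z,Z), so a generator multiplying \<rho> by m needs a map B that multiplies g_M by m; hence
  \<open>Heis\<close> acts on Z by sqrt r although it fixes every z^a. Moreover B(1,z) has to be a
  positive real multiple of (1,z'), where z' is the image of z: a phase would leave the gauge
  Arg(Z^0) = 0 and rotate t = w/z, which the lift has to fix. The factor m must be constant and not
  merely nonvanishing: only then is the kernel of d\<lambda>~, and with it the complex structure,
  carried along as well. Since group elements are words in the generators, the properties of the
  lift are collected in a form that is closed under composition.\<close>

definition tri :: "('n \<Rightarrow> 'n \<Rightarrow> 'n \<Rightarrow> real) \<Rightarrow> 'a::real_normed_field^'n::finite \<Rightarrow> 'a^'n \<Rightarrow> 'a^'n \<Rightarrow> 'a"
  where "tri k x y z = (\<Sum>a\<in>UNIV. \<Sum>b\<in>UNIV. \<Sum>c\<in>UNIV. of_real (k a b c) * x$a * y$b * z$c)"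

lemma cubic_tri: "cubic k x = tri k x x x / 6"
  by (simp add: cubic_def tri_def)

lemma tri_add:
  "tri k (x + x') y z = tri k x y z + tri k x' y z"
  "tri k x (y + y') z = tri k x y z + tri k x y' z"
  "tri k x y (z + z') = tri k x y z + tri k x y z'"
  by (simp_all add: tri_def algebra_simps sum.distrib)

lemma tri_scale:
  "tri k (c *s x) y z = c * tri k x y z"
  "tri k x (c *s y) z = c * tri k x y z"
  "tri k x y (c *s z) = c * tri k x y z"
  by (simp_all add: tri_def sum_distrib_left mult_ac)

lemma tri_commute:
  assumes "symmetric_coeffs k"
  shows "tri k x y z = tri k y x z" "tri k x y z = tri k x z y"
proof -
  show "tri k x y z = tri k y x z"
    unfolding tri_def
    by (subst sum.swap) (use assms in \<open>simp add: symmetric_coeffs_def mult_ac\<close>)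
  show "tri k x y z = tri k x z y"
    unfolding tri_def
    by (rule sum.cong[OF refl], subst sum.swap) (use assms in \<open>simp add: symmetric_coeffs_def mult_ac\<close>)
qed

lemma tri_cvec: "tri k (cvec x) (cvec y) (cvec z) = of_real (tri k x y z)"
  by (simp add: tri_def cvec_def)

lemma sum_option: "(\<Sum>i\<in>UNIV. f i) = f None + (\<Sum>a\<in>UNIV. f (Some a))"
  for f :: "'n::finite option \<Rightarrow> 'b::comm_monoid_add"
  by (simp add: UNIV_option_conv sum.reindex)

lemma sum_axis: "(\<Sum>b\<in>UNIV. f b * axis a (s::'a::semiring_1) $ b) = f a * s"
  by (simp add: axis_def if_distrib[of "\<lambda>t. _ * t"] cong: if_cong)

lemma tri_axis:
  "tri k (axis a s) y z = s * (\<Sum>b\<in>UNIV. \<Sum>c\<in>UNIV. of_real (k a b c) * y$b * z$c)"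
proof -
  have "tri k (axis a s) y z = (\<Sum>a'\<in>UNIV. (\<Sum>b\<in>UNIV. \<Sum>c\<in>UNIV. of_real (k a' b c) * y$b * z$c) * axis a s $ a')"
    by (simp add: tri_def sum_distrib_right sum_distrib_left mult_ac)
  then show ?thesis by (simp only: sum_axis mult.commute[of s])
qed

lemma axis_nth_None: "axis (Some a) s $ None = 0" "axis None s $ None = s"
  by (simp_all add: axis_def)

lemma affine_part_axis: "affine_part (X + axis None s) = affine_part X"
  "affine_part (X + axis (Some a) s) = affine_part X + s *s axis a 1"
  by (simp_all add: affine_part_def axis_def vec_eq_iff)

text \<open>Closed form of F_i at arbitrary Z and not only at (1,z): second derivatives need it in a
  neighbourhood, and the lift moves Z^0. Inserting \<open>axis a 1\<close> into one slot of
  \<open>tri\<close> produces the contraction k_abc Z^b Z^c.\<close>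

definition grad :: "('n \<Rightarrow> 'n \<Rightarrow> 'n \<Rightarrow> real) \<Rightarrow> complex^('n::finite option) \<Rightarrow> 'n option \<Rightarrow> complex"
  where "grad k Z i = (case i of None \<Rightarrow> cubic k (affine_part Z) / (Z$None)\<^sup>2
    | Some a \<Rightarrow> - tri k (axis a 1) (affine_part Z) (affine_part Z) / (2 * Z$None))"

definition hess :: "('n \<Rightarrow> 'n \<Rightarrow> 'n \<Rightarrow> real) \<Rightarrow> complex^('n::finite option) \<Rightarrow> 'n option \<Rightarrow> 'n option \<Rightarrow> complex"
  where "hess k Z i j = (case i of
      None \<Rightarrow> (case j of
        None \<Rightarrow> - 2 * cubic k (affine_part Z) / (Z$None)^3
      | Some b \<Rightarrow> tri k (axis b 1) (affine_part Z) (affine_part Z) / (2 * (Z$None)\<^sup>2))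
    | Some a \<Rightarrow> (case j of
        None \<Rightarrow> tri k (axis a 1) (affine_part Z) (affine_part Z) / (2 * (Z$None)\<^sup>2)
      | Some b \<Rightarrow> - tri k (axis a 1) (axis b 1) (affine_part Z) / Z$None))"

text \<open>Taylor expansion along a line. For symmetric coefficients \<open>tri\<close> is six
  times the polarization of h and the mixed terms merge, so the coefficient of s is the derivative
  of the numerator that \<open>cpartial\<close> meets.\<close>

lemma tri_line:
  fixes s :: "'a::real_normed_field"
  assumes "symmetric_coeffs k"
  shows "tri k x (y + s *s e) (y + s *s e) = tri k x y y + 2 * s * tri k e x y + s\<^sup>2 * tri k x e e"
    and "tri k (y + s *s e) (y + s *s e) (y + s *s e)
      = tri k y y y + 3 * s * tri k e y y + 3 * s\<^sup>2 * tri k e e y + s^3 * tri k e e e"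
  by (simp_all add: tri_add tri_scale tri_commute[OF assms] algebra_simps power2_eq_square power3_eq_cube)

lemma cpartial_prepotential:
  assumes k: "symmetric_coeffs k" and Z: "Z$None \<noteq> 0"
  shows "cpartial i (prepotential k) Z = grad k Z i"
proof (cases i)
  case None
  have "((\<lambda>s. prepotential k (Z + axis None s)) has_field_derivative grad k Z None) (at 0)"
    unfolding prepotential_def affine_part_axis
    using Z by (auto intro!: derivative_eq_intros simp: axis_nth_None grad_def field_simps power2_eq_square)
  then show ?thesis
    by (simp add: None cpartial_def DERIV_imp_deriv)
next
  case (Some a)
  have "((\<lambda>s. prepotential k (Z + axis (Some a) s)) has_field_derivative grad k Z (Some a)) (at 0)"
    unfolding prepotential_def affine_part_axis cubic_tri tri_line(2)[OF k]
    using Z by (auto intro!: derivative_eq_intros simp: grad_def field_simps power2_eq_square axis_nth_None)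
  then show ?thesis
    by (simp add: Some cpartial_def DERIV_imp_deriv)
qed

lemma grad_F_eq:
  assumes "symmetric_coeffs k" "Z$None \<noteq> 0"
  shows "grad_F k Z = (\<chi> i. grad k Z i)"
  using assms by (simp add: grad_F_def cpartial_prepotential)

lemma cpartial_grad:
  assumes k: "symmetric_coeffs k" and Z: "Z$None \<noteq> 0"
  shows "cpartial i (\<lambda>Z. grad k Z j) Z = hess k Z i j"
proof -
  have "((\<lambda>s. grad k (Z + axis i s) j) has_field_derivative hess k Z i j) (at 0)"
  proof (cases i; cases j)
    assume ij: "i = None" "j = None"
    then show ?thesis unfolding ij grad_def hess_def option.case affine_part_axis
      using Z by (auto intro!: derivative_eq_intros simp: field_simps power2_eq_square power3_eq_cube)
  next
    fix b assume ij: "i = None" "j = Some b"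
    then show ?thesis unfolding ij grad_def hess_def option.case affine_part_axis
      using Z by (auto intro!: derivative_eq_intros simp: field_simps power2_eq_square power3_eq_cube)
  next
    fix a assume ij: "i = Some a" "j = None"
    then show ?thesis unfolding ij grad_def hess_def option.case affine_part_axis cubic_tri tri_line(2)[OF k]
      using Z by (auto intro!: derivative_eq_intros simp: field_simps axis_nth_None power2_eq_square power3_eq_cube)
  next
    fix a b assume ij: "i = Some a" "j = Some b"
    then show ?thesis unfolding ij grad_def hess_def option.case affine_part_axis tri_line(1)[OF k]
      using Z by (auto intro!: derivative_eq_intros simp: field_simps axis_nth_None power2_eq_square power3_eq_cube)
  qed
  then show ?thesis by (simp add: cpartial_def DERIV_imp_deriv)
qed

lemma open_None_nz: "open {Z::complex^('n::finite option). Z$None \<noteq> 0}"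
proof -
  have "open ((\<lambda>Z::complex^('n option). Z$None) -` (- {0}))"
    by (intro continuous_open_vimage) (auto intro!: continuous_intros)
  then show ?thesis by (simp add: vimage_def)
qed

text \<open>A second partial derivative sees the first one on a whole neighbourhood, so the closed
  form has to hold near s = 0. For this the line must stay off Z^0 = 0, a matter only for the
  direction of index 0.\<close>

lemma hess_F_eq:
  assumes k: "symmetric_coeffs k" and Z: "Z$None \<noteq> 0"
  shows "hess_F k Z $ i $ j = hess k Z i j"
proof -
  have "\<forall>\<^sub>F s in nhds 0. (Z + axis i s)$None \<noteq> 0"
  proof -
    have "isCont (\<lambda>s. Z$None + axis i s $ None) 0"
      by (cases i) (auto simp: axis_def)
    moreover have "Z$None + axis i 0 $ None \<noteq> 0"
      using Z by (simp add: axis_def)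
    ultimately have "\<forall>\<^sub>F s in at 0. Z$None + axis i s $ None \<noteq> 0"
      by (metis isCont_def tendsto_imp_eventually_ne)
    then show ?thesis using Z by (simp add: eventually_at_filter eventually_mono axis_def)
        (auto elim!: eventually_mono simp: axis_def)
  qed
  then have "\<forall>\<^sub>F s in nhds 0. cpartial j (prepotential k) (Z + axis i s) = grad k (Z + axis i s) j"
    by (rule eventually_mono) (rule cpartial_prepotential[OF k])
  then have "cpartial i (cpartial j (prepotential k)) Z = cpartial i (\<lambda>Z. grad k Z j) Z"
    unfolding cpartial_def[of i] by (intro deriv_cong_ev) auto
  then show ?thesis using cpartial_grad[OF k Z] by (simp add: hess_F_def)
qed

section \<open>Vectors indexed by 0..n, split into the component 0 and the rest\<close>

definition ocons :: "'a \<Rightarrow> 'a^'n::finite \<Rightarrow> 'a^('n option)"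
  where "ocons x X = (\<chi> i. case i of None \<Rightarrow> x | Some a \<Rightarrow> X$a)"

definition tail :: "'a^('n::finite option) \<Rightarrow> 'a^'n"
  where "tail x = (\<chi> a. x$(Some a))"

definition dot :: "'a::comm_ring_1^'n::finite \<Rightarrow> 'a^'n \<Rightarrow> 'a"
  where "dot x y = (\<Sum>a\<in>UNIV. x$a * y$a)"

definition cov :: "('n \<Rightarrow> 'n \<Rightarrow> 'n \<Rightarrow> real) \<Rightarrow> 'a::real_normed_field^'n::finite \<Rightarrow> 'a^'n \<Rightarrow> 'a^'n"
  where "cov k x y = (\<chi> a. tri k (axis a 1) x y)"

text \<open>Unlike in \<open>cvec\<close> the target field is left open: over the reals this is the
  identity, so the same formulas serve the coordinates of the q-map space and the complex Darboux
  coordinates.\<close>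

definition ovec :: "real^'m \<Rightarrow> 'a::real_normed_field^'m"
  where "ovec x = (\<chi> i. of_real (x$i))"

lemma ocons_nth [simp]: "ocons x X $ None = x" "ocons x X $ Some a = X $ a"
  by (simp_all add: ocons_def)

lemma tail_nth [simp]: "tail x $ a = x $ Some a"
  by (simp add: tail_def)

lemma tail_ocons [simp]: "tail (ocons x X) = X"
  by (simp add: vec_eq_iff)

lemma ocons_eqI: "x $ None = x' $ None \<Longrightarrow> tail x = tail x' \<Longrightarrow> x = x'"
  by (metis (no_types, lifting) vec_eq_iff tail_nth not_None_eq)

lemma tail_linear [simp]:
  "tail (x + y) = tail x + tail y" "tail (c *s x) = c *s tail x" "tail (ovec v) = ovec (tail v)"
  "tail (- u) = - tail u" "tail (u - w) = tail u - tail w"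
  for u w :: "'a::ab_group_add^('n::finite option)"
  by (simp_all add: vec_eq_iff ovec_def)

lemma affine_part_tail: "affine_part = tail"
  by (simp add: fun_eq_iff affine_part_def tail_def)

lemma ovec_nth [simp]: "ovec x $ i = of_real (x $ i)"
  by (simp add: ovec_def)

lemma ovec_real [simp]: "ovec x = x"
  by (simp add: vec_eq_iff)

lemma ovec_linear [simp]: "ovec (c *s x) = of_real c *s ovec x" "ovec (x + y) = ovec x + ovec y"
  by (simp_all add: vec_eq_iff)

lemma ovec_0 [simp]: "ovec 0 = 0"
  by (simp add: vec_eq_iff)

lemma cvec_ovec: "cvec = ovec"
  by (simp add: fun_eq_iff vec_eq_iff cvec_def)

lemma hom_ocons: "hom z = ocons 1 z"
  by (rule ocons_eqI) (simp_all add: hom_def vec_eq_iff)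

lemma dot_linear:
  "dot (x + x') y = dot x y + dot x' y" "dot x (y + y') = dot x y + dot x y'"
  "dot (x - x') y = dot x y - dot x' y" "dot x (y - y') = dot x y - dot x y'"
  "dot (c *s x) y = c * dot x y" "dot x (c *s y) = c * dot x y"
  by (simp_all add: dot_def algebra_simps sum.distrib sum_subtractf sum_distrib_left)

lemma dot_uminus: "dot (- x) y = - dot x y"
  by (simp add: dot_def sum_negf)

lemma dot_commute: "dot x y = dot y x"
  by (simp add: dot_def mult.commute)

lemma dot_cov: "dot (cov k x y) z = tri k z x y"
proof -
  have "tri k z x y = (\<Sum>a\<in>UNIV. z$a * (\<Sum>b\<in>UNIV. \<Sum>c\<in>UNIV. of_real (k a b c) * x$b * y$c))"
    by (simp add: tri_def sum_distrib_left mult_ac)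
  then show ?thesis
    by (simp add: dot_def cov_def tri_axis mult.commute)
qed

lemma cov_linear:
  "cov k (x + x') y = cov k x y + cov k x' y" "cov k x (y + y') = cov k x y + cov k x y'"
  "cov k (c *s x) y = c *s cov k x y" "cov k x (c *s y) = c *s cov k x y"
  by (simp_all add: cov_def vec_eq_iff tri_add tri_scale)

lemma cov_commute: "symmetric_coeffs k \<Longrightarrow> cov k x y = cov k y x"
  by (simp add: cov_def vec_eq_iff tri_commute(2)[where y = x])

lemma symp_dot:
  "symp (x, y) (x', y') = x$None * y'$None + dot (tail x) (tail y')
     - (y$None * x'$None + dot (tail y) (tail x'))"
  by (simp add: symp_def sum_option dot_def sum_subtractf)

section \<open>Linear parts of the generators\<close>

fun pair_rule ::
    "('n \<Rightarrow> 'n \<Rightarrow> 'n \<Rightarrow> real) \<Rightarrow> 'n::finite L_gen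
      \<Rightarrow> ('a::real_normed_field^('n option)) \<times> ('a^('n option)) \<Rightarrow> ('a^('n option)) \<times> ('a^('n option))"
  where
    "pair_rule k (Heis r \<eta>t \<eta> \<kappa>) (x, y) = (of_real (sqrt r) *s x, of_real (sqrt r) *s y)"
  | "pair_rule k (Dil l) (x, y) =
      (ocons (of_real (l powr (3/2)) * x$None) (of_real (l powr (1/2)) *s tail x),
       ocons (of_real (l powr (-3/2)) * y$None) (of_real (l powr (-1/2)) *s tail y))"
  | "pair_rule k (Shift v) (x, y) =
      (ocons (x$None + tri k (ovec v) (ovec v) (ovec v) / 6 * y$None
               + tri k (ovec v) (ovec v) (tail y) / 2 - dot (tail x) (ovec v))
         (tail x - (y$None / 2) *s cov k (ovec v) (ovec v) - cov k (ovec v) (tail y)),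
       ocons (y$None) (tail y + (y$None) *s ovec v))"

text \<open>The linear part of a generator, the map P, is block triangular: its second component
  depends on \<zeta>^i alone. That component can therefore be applied to Z, and it is the map
  B.\<close>

fun Z_rule :: "'n::finite L_gen \<Rightarrow> 'a::real_normed_field^('n option) \<Rightarrow> 'a^('n option)"
  where
    "Z_rule (Heis r \<eta>t \<eta> \<kappa>) y = of_real (sqrt r) *s y"
  | "Z_rule (Dil l) y = ocons (of_real (l powr (-3/2)) * y$None) (of_real (l powr (-1/2)) *s tail y)"
  | "Z_rule (Shift v) y = ocons (y$None) (tail y + (y$None) *s ovec v)"

fun multiplier :: "'n::finite L_gen \<Rightarrow> real"
  where "multiplier (Heis r \<eta>t \<eta> \<kappa>) = r" | "multiplier (Dil l) = 1" | "multiplier (Shift v) = 1"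

fun translation :: "'n::finite L_gen \<Rightarrow> (real, 'n) fibre"
  where "translation (Heis r \<eta>t \<eta> \<kappa>) = (\<eta>t, \<eta>, \<kappa>)" | "translation (Dil l) = 0" | "translation (Shift v) = 0"

lemma multiplier_pos: "valid_gen g \<Longrightarrow> multiplier g > 0"
  by (cases g) auto

lemma snd_pair_rule: "snd (pair_rule k g (x, y)) = Z_rule g y"
  by (cases g) auto

lemma rho_rule_multiplier: "rho_rule g \<rho> = multiplier g * \<rho>"
  by (cases g) auto

text \<open>In the Heisenberg law, the term of the rule for \<sigma> that mixes \<eta> and \<zeta>
  is the symplectic pairing of the linear part with the translation. For \<open>Dil\<close> and
  \<open>Shift\<close> the translation is 0, so one formula covers all generators over both scalar
  fields.\<close>

lemma fibre_rule_eq: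
  fixes x y :: "'a::real_normed_field^('n::finite option)"
  assumes "valid_gen g" and "translation g = (et, e, \<kappa>)"
  shows "fibre_rule k g (x, y, s) =
     (fst (pair_rule k g (x, y)) + ovec et, Z_rule g y + ovec e,
      of_real \<kappa> + of_real (multiplier g) * s + symp (pair_rule k g (x, y)) (ovec et, ovec e))"
proof (cases g)
  case (Heis r \<eta>t \<eta> \<kappa>)
  then show ?thesis using assms
    by (auto simp: vec_eq_iff symp_def sum_distrib_left algebra_simps)
next
  case (Dil l)
  then show ?thesis using assms
    by (auto simp: vec_eq_iff symp_def zero_prod_def split: option.splits)
next
  case (Shift v)
  have "(\<Sum>a\<in>UNIV. \<Sum>b\<in>UNIV. \<Sum>c\<in>UNIV. of_real (k a b c * v$a * v$b) * y$(Some c))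
      = tri k (ovec v) (ovec v) (tail y)"
    "(\<Sum>a\<in>UNIV. \<Sum>b\<in>UNIV. \<Sum>c\<in>UNIV. of_real (k a b c * v$a * v$b * v$c))
      = (tri k (ovec v) (ovec v) (ovec v) :: 'a)"
    by (simp_all add: tri_def)
  moreover have "(\<Sum>b\<in>UNIV. \<Sum>c\<in>UNIV. of_real (k a b c * v$b) * y$(Some c))
      = cov k (ovec v) (tail y) $ a"
    "(\<Sum>b\<in>UNIV. \<Sum>c\<in>UNIV. of_real (k a b c * v$b * v$c)) = (cov k (ovec v) (ovec v) $ a :: 'a)" for a
    by (simp_all add: cov_def tri_axis)
  ultimately show ?thesis using assms unfolding Shift
    by (auto simp: vec_eq_iff symp_def zero_prod_def dot_def split: option.splits)
qed

text \<open>Additivity (c = 1) and homogeneity (zero first summands) in one identity. The scalar c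
  comes from the field of the entries, because the Darboux coordinates combine (F,Z) and its
  conjugate with complex coefficients.\<close>

lemma pair_rule_linear:
  "pair_rule k g (x + c *s x', y + c *s y') =
    (fst (pair_rule k g (x, y)) + c *s fst (pair_rule k g (x', y')), Z_rule g y + c *s Z_rule g y')"
proof (cases g)
  case (Shift v)
  show ?thesis unfolding Shift
    by (auto intro!: ocons_eqI simp: tri_add tri_scale dot_linear cov_linear algebra_simps)
      (simp_all add: vec_eq_iff algebra_simps add_divide_distrib)
next
  case (Dil l)
  show ?thesis unfolding Dil
    by (auto intro!: ocons_eqI simp: algebra_simps)
qed (simp add: vec_eq_iff algebra_simps)

text \<open>\<open>Heis\<close> scales both arguments by sqrt r; under \<open>Dil\<close> the
  weights of \<zeta>t_i and \<zeta>^i are reciprocal; for \<open>Shift\<close> the terms containing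
  v cancel degree by degree, using the symmetry of k.\<close>

lemma symp_pair_rule:
  fixes x y x' y' :: "'a::real_normed_field^('n::finite option)"
  assumes k: "symmetric_coeffs k" and g: "valid_gen g"
  shows "symp (pair_rule k g (x, y)) (pair_rule k g (x', y')) = of_real (multiplier g) * symp (x, y) (x', y')"
proof (cases g)
  case (Heis r et e \<kappa>)
  then have "of_real r = (of_real (sqrt r) * of_real (sqrt r) :: 'a)"
    using g by (simp flip: of_real_mult)
  then show ?thesis
    unfolding Heis by (simp add: symp_dot dot_linear algebra_simps)
next
  case (Dil l)
  have l: "of_real (l powr (3/2)) * (of_real (l powr - (3/2)) * z) = (z :: 'a)"
    "of_real (l powr - (3/2)) * (of_real (l powr (3/2)) * z) = (z :: 'a)"
    "of_real (l powr (1/2)) * (of_real (l powr - (1/2)) * z) = (z :: 'a)"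
    "of_real (l powr - (1/2)) * (of_real (l powr (1/2)) * z) = (z :: 'a)" for z
    using g Dil unfolding mult.assoc[symmetric] of_real_mult[symmetric] powr_add[symmetric] by simp_all
  show ?thesis
    unfolding Dil by (simp add: symp_dot dot_linear mult.left_commute mult.assoc l del: powr_minus_divide)
next
  case (Shift v)
  show ?thesis
    unfolding Shift
    by (simp add: symp_dot dot_linear dot_cov dot_commute[of _ "cov _ _ _"] tri_commute[OF k] tri_add tri_scale)
      (simp add: algebra_simps tri_commute[OF k] dot_commute)
qed

lemma grad_F_ocons:
  assumes "symmetric_coeffs k" "Z$None \<noteq> 0"
  shows "grad_F k Z = ocons (tri k (tail Z) (tail Z) (tail Z) / (6 * (Z$None)\<^sup>2))
    ((- 1 / (2 * Z$None)) *s cov k (tail Z) (tail Z))"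
  by (rule ocons_eqI)
    (simp_all add: grad_F_eq[OF assms] grad_def vec_eq_iff cov_def affine_part_tail cubic_tri)

lemma Z_rule_nonzero: "valid_gen g \<Longrightarrow> Z_rule g Z $ None \<noteq> 0 \<longleftrightarrow> Z $ None \<noteq> 0"
  by (cases g) auto

text \<open>The Lagrangian cone of all (F_i(Z), Z^i) is mapped to itself. For \<open>Heis\<close>
  this is the homogeneity of F_i of degree one, for \<open>Dil\<close> a count of weights. For
  \<open>Shift\<close> it is the Taylor expansion of the cubic and its derivatives about Z^a in the
  direction Z^0 v^a, whose terms, ordered by degree in v, are those of the rule for
  \<zeta>t_i.\<close>

lemma pair_rule_grad:
  assumes k: "symmetric_coeffs k" and g: "valid_gen g" and Z: "Z$None \<noteq> 0"
  shows "fst (pair_rule k g (grad_F k Z, Z)) = grad_F k (Z_rule g Z)"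
proof -
  have Z': "Z_rule g Z $ None \<noteq> 0" using Z g by (simp add: Z_rule_nonzero)
  show ?thesis
  proof (cases g)
    case (Heis r et e \<kappa>)
    show ?thesis
      unfolding grad_F_ocons[OF k Z] grad_F_ocons[OF k Z'] using Z g Heis
      by (auto intro!: ocons_eqI simp: cov_linear tri_scale field_simps power2_eq_square)
  next
    case (Dil l)
    \<comment> \<open>In terms of q all weights are integral powers, which field arithmetic can
      cancel.\<close>
    define q where "q = l powr (1/2)"
    have q: "q > 0" "l powr (3/2) = q^3" "l powr (-3/2) = 1 / q^3" "l powr (-1/2) = 1 / q"
      using g Dil by (simp_all add: q_def powr_power powr_minus_divide)
    show ?thesis
      unfolding grad_F_ocons[OF k Z] grad_F_ocons[OF k Z'] using Z q unfolding Dil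
      by (auto intro!: ocons_eqI simp: q q_def[symmetric] cov_linear tri_scale field_simps power2_eq_square power3_eq_cube)
  next
    case (Shift v)
    show ?thesis
      unfolding grad_F_ocons[OF k Z] grad_F_ocons[OF k Z'] using Z unfolding Shift
      apply (auto intro!: ocons_eqI simp: cov_linear cov_commute[OF k, of "tail Z" "ovec v"] tri_commute[OF k] tri_add tri_scale dot_linear dot_uminus dot_cov)
      subgoal by (simp add: field_simps power2_eq_square)
      subgoal by (simp add: vec_eq_iff field_simps power2_eq_square)
      done
  qed
qed

section \<open>The Hessian of the prepotential and the metric of M\<close>

definition bil :: "('n \<Rightarrow> 'n \<Rightarrow> 'n \<Rightarrow> real) \<Rightarrow> complex^('n::finite option) \<Rightarrow> complex^('n option) \<Rightarrow> complex^('n option) \<Rightarrow> complex"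
  where "bil k Z x y = (\<Sum>i\<in>UNIV. \<Sum>j\<in>UNIV. hess_F k Z $ i $ j * x$i * y$j)"

lemma tri_sum: "tri k x y z = (\<Sum>a\<in>UNIV. tri k (axis a 1) y z * x$a)"
  by (simp add: tri_axis) (simp add: tri_def sum_distrib_left sum_distrib_right mult_ac)

text \<open>Second derivatives of F are homogeneous of degree 0, so only q = Z^a/Z^0 enters. It is a
  parameter fixed by an equation rather than a quotient, so that for a transformed Z one can insert
  q + v or l q at once.\<close>

lemma bil_eq:
  assumes k: "symmetric_coeffs k" and Z: "Z$None \<noteq> 0" and q: "tail Z = Z$None *s q"
  shows "bil k Z x y = - tri k q q q / 3 * x$None * y$None
    + (tri k (tail x) q q * y$None + tri k (tail y) q q * x$None) / 2 - tri k (tail x) (tail y) q"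
proof -
  have 1: "(\<Sum>a\<in>UNIV. tri k (axis a 1) q q * x$(Some a)) = tri k (tail x) q q" for x
    by (subst (2) tri_sum) simp
  have "tri k (tail x) (tail y) q = (\<Sum>a\<in>UNIV. tri k (tail y) (axis a 1) q * x$(Some a))"
    by (subst tri_sum) (simp add: tri_commute(1)[OF k, of "tail y"])
  also have "\<dots> = (\<Sum>a\<in>UNIV. \<Sum>b\<in>UNIV. tri k (axis a 1) (axis b 1) q * x$(Some a) * y$(Some b))"
    unfolding tri_sum[where x = "tail y"] sum_distrib_right
    by (intro sum.cong refl) (metis (no_types, lifting) tri_commute(1)[OF k] tail_nth mult.commute mult.assoc)
  finally have 2: "(\<Sum>a\<in>UNIV. \<Sum>b\<in>UNIV. tri k (axis a 1) (axis b 1) q * x$(Some a) * y$(Some b))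
      = tri k (tail x) (tail y) q" ..
  have H: "hess k Z None None = - tri k q q q / 3"
    "hess k Z None (Some b) = tri k (axis b 1) q q / 2"
    "hess k Z (Some a) None = tri k (axis a 1) q q / 2"
    "hess k Z (Some a) (Some b) = - tri k (axis a 1) (axis b 1) q" for a b
    using Z by (simp_all add: hess_def affine_part_tail cubic_tri q tri_scale power2_eq_square power3_eq_cube)
  have "bil k Z x y = - tri k q q q / 3 * x$None * y$None
    + (\<Sum>a\<in>UNIV. tri k (axis a 1) q q * y$(Some a)) * x$None / 2
    + ((\<Sum>a\<in>UNIV. tri k (axis a 1) q q * x$(Some a)) * y$None / 2
    - (\<Sum>a\<in>UNIV. \<Sum>b\<in>UNIV. tri k (axis a 1) (axis b 1) q * x$(Some a) * y$(Some b)))"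
    unfolding bil_def hess_F_eq[OF k Z] sum_option H
    by (simp add: sum.distrib sum_subtractf sum_negf sum_distrib_left sum_distrib_right sum_divide_distrib mult_ac)
  then show ?thesis
    unfolding 1 2 by (simp add: algebra_simps add_divide_distrib)
qed

lemma bil_linear:
  "bil k Z (x + x') y = bil k Z x y + bil k Z x' y" "bil k Z x (y + y') = bil k Z x y + bil k Z x y'"
  "bil k Z (c *s x) y = c * bil k Z x y" "bil k Z x (c *s y) = c * bil k Z x y"
  by (simp_all add: bil_def algebra_simps sum.distrib sum_distrib_left)

lemma tail_quotient: "Z$None \<noteq> 0 \<Longrightarrow> tail Z = Z$None *s (\<chi> a. Z$(Some a) / Z$None)"
  for Z :: "'a::field^('n::finite option)"
  by (simp add: vec_eq_iff)

lemma bil_commute: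
  assumes "symmetric_coeffs k" "Z$None \<noteq> 0"
  shows "bil k Z x y = bil k Z y x"
  unfolding bil_eq[OF assms tail_quotient[OF assms(2)]] tri_commute(1)[OF assms(1), of "tail x" "tail y"]
  by (simp add: algebra_simps)

definition Re_vec :: "complex^'m \<Rightarrow> real^'m"
  where "Re_vec z = (\<chi> a. Re (z$a))"

lemma Re_Im_vec_nth [simp]: "Re_vec z $ a = Re (z $ a)" "Im_vec z $ a = Im (z $ a)"
  by (simp_all add: Re_vec_def Im_vec_def)

text \<open>Re (u cnj v) is the sum of the product of the real parts and that of the imaginary
  parts, so g_M is determined by the imaginary part of the Hessian on real vectors. Real vectors are
  essential: only on them is the correction produced by a shift real.\<close>

lemma M_metric_bil:
  "M_metric k Z u v = - Im (bil k Z (ovec (Re_vec u)) (ovec (Re_vec v)))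
     - Im (bil k Z (ovec (Im_vec u)) (ovec (Im_vec v)))"
proof -
  have "- Im h * Re (p * cnj q) = - Im (h * of_real (Re p) * of_real (Re q)) - Im (h * of_real (Im p) * of_real (Im q))"
    for h p q :: complex
    by (simp add: algebra_simps)
  then show ?thesis
    by (simp only: M_metric_def bil_def sum_subtractf sum_negf Im_sum ovec_nth Re_Im_vec_nth)
qed

lemma Re_Im_vec_Z_rule: "Re_vec (Z_rule g u) = Z_rule g (Re_vec u)" "Im_vec (Z_rule g u) = Z_rule g (Im_vec u)"
  by (cases g; simp add: Re_vec_def Im_vec_def ocons_def vec_eq_iff split: option.split)+

lemma tri_ovec: "tri k (ovec x) (ovec y) (ovec z) = (of_real (tri k x y z) :: complex)"
  using tri_cvec[of k x y z] by (simp add: cvec_ovec)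

text \<open>For a shift the prepotential changes by a quadratic polynomial with real coefficients, which the
  imaginary part of the Hessian does not see.\<close>

lemma Im_bil_Z_rule:
  assumes k: "symmetric_coeffs k" and g: "valid_gen g" and Z: "Z$None \<noteq> 0"
  shows "Im (bil k (Z_rule g Z) (ovec (Z_rule g x)) (ovec (Z_rule g y)))
    = multiplier g * Im (bil k Z (ovec x) (ovec y))"
proof -
  have Z': "Z_rule g Z $ None \<noteq> 0" using Z g by (simp add: Z_rule_nonzero)
  define q where "q = (\<chi> a. Z$(Some a) / Z$None)"
  have q: "tail Z = Z$None *s q" using tail_quotient[OF Z] by (simp add: q_def)
  note eq = bil_eq[OF k Z q]
  show ?thesis
  proof (cases g)
    case (Heis r et e \<kappa>)
    define s where "s = sqrt r"
    have s: "s > 0" "r = s * s" using g Heis by (simp_all add: s_def)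
    have "ovec (Z_rule g x) = of_real s *s (ovec x :: complex^_)" for x
      by (simp add: Heis vec_eq_iff s_def)
    moreover have "tail (Z_rule g Z) = Z_rule g Z $ None *s q"
      by (simp add: Heis q)
    then have "bil k (Z_rule g Z) x y = bil k Z x y" for x y
      using bil_eq[OF k Z'] eq by simp
    ultimately show ?thesis
      by (simp add: bil_linear Heis s)
  next
    case (Dil l)
    define s where "s = l powr (1/2)"
    have s: "s > 0" "l powr (3/2) = s^3" "l powr (-3/2) = 1 / s^3" "l powr (-1/2) = 1 / s"
      using g Dil by (simp_all add: s_def powr_power powr_minus_divide)
    have "tail (Z_rule g Z) = Z_rule g Z $ None *s (of_real (s * s) *s q)"
      unfolding Dil using s by (simp add: q s vec_eq_iff power3_eq_cube)
    note eq' = bil_eq[OF k Z' this]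
    have "bil k (Z_rule g Z) (ovec (Z_rule g x)) (ovec (Z_rule g y)) = bil k Z (ovec x) (ovec y)"
      unfolding eq' eq tail_linear unfolding Dil Z_rule.simps tail_ocons ocons_nth ovec_nth ovec_linear s tri_scale
      using s(1) by (simp add: field_simps power3_eq_cube)
    then show ?thesis by (simp add: Dil)
  next
    case (Shift v)
    have "tail (Z_rule g Z) = Z_rule g Z $ None *s (q + ovec v)"
      unfolding Shift by (simp add: q vec_eq_iff algebra_simps)
    note eq' = bil_eq[OF k Z' this]
    have "bil k (Z_rule g Z) (ovec (Z_rule g x)) (ovec (Z_rule g y)) - bil k Z (ovec x) (ovec y)
      = - tri k (ovec v) (ovec v) (ovec v) / 3 * ovec x$None * ovec y$None
          - (tri k (ovec v) (ovec v) (tail (ovec x)) * ovec y$None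
             + tri k (ovec v) (ovec v) (tail (ovec y)) * ovec x$None) / 2
          - tri k (ovec v) (tail (ovec x)) (tail (ovec y))"
      unfolding eq' eq unfolding Shift
      by (simp add: tri_add tri_scale tri_commute[OF k]) (simp add: field_simps)
    also have "\<dots> = of_real (- tri k v v v / 3 * x$None * y$None
          - (tri k v v (tail x) * y$None + tri k v v (tail y) * x$None) / 2 - tri k v (tail x) (tail y))"
      by (simp add: tri_ovec)
    finally show ?thesis by (simp add: Shift complex_eq_iff)
  qed
qed

lemma M_metric_Z_rule:
  assumes "symmetric_coeffs k" "valid_gen g" "Z$None \<noteq> 0"
  shows "M_metric k (Z_rule g Z) (Z_rule g u) (Z_rule g v) = multiplier g * M_metric k Z u v"
  by (simp only: M_metric_bil Re_Im_vec_Z_rule Im_bil_Z_rule[OF assms]) (simp add: right_diff_distrib)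

lemma Z_rule_scale: "Z_rule g (c *s Z) = c *s Z_rule g Z"
  by (cases g) (auto simp: ocons_def vec_eq_iff algebra_simps split: option.splits)

lemma r_sq_Z_rule:
  assumes "symmetric_coeffs k" "valid_gen g" "Z$None \<noteq> 0"
  shows "r_sq k (Z_rule g Z) = multiplier g * r_sq k Z"
  by (simp add: r_sq_def M_metric_Z_rule[OF assms])

lemma r_sq_bil:
  assumes "symmetric_coeffs k" "Z$None \<noteq> 0"
  shows "r_sq k Z = - Im (bil k Z Z (cnj_vec Z))"
proof -
  define x y :: "complex^('a option)" where "x = ovec (Re_vec Z)" and "y = ovec (Im_vec Z)"
  have "bil k Z (x + \<i> *s y) (x + (- \<i>) *s y) = bil k Z x x + bil k Z y y"
    unfolding bil_linear using bil_commute[OF assms, of y x] by (simp add: algebra_simps)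
  moreover have "x + \<i> *s y = Z" "x + (- \<i>) *s y = cnj_vec Z"
    by (simp_all add: x_def y_def vec_eq_iff cnj_vec_def complex_eq_iff)
  ultimately show ?thesis
    by (simp add: r_sq_def M_metric_bil x_def y_def)
qed

text \<open>Since K = 8h(t), this is |Z^0|^2 K/2. It yields the positivity of r^2 over the cone and
  its behaviour under complex scaling of Z.\<close>

lemma r_sq_eq:
  assumes k: "symmetric_coeffs k" and Z: "Z$None \<noteq> 0"
  shows "r_sq k Z = 4 * (cmod (Z$None))\<^sup>2 * cubic k (Im_vec (\<chi> a. Z$(Some a) / Z$None))"
proof -
  define c where "c = Z$None"
  define b where "b = Re_vec (\<chi> a. Z$(Some a) / Z$None)"
  define t where "t = Im_vec (\<chi> a. Z$(Some a) / c)"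
  have c: "c \<noteq> 0" using Z by (simp add: c_def)
  have Z_Some: "Z$(Some a) = c * (of_real (b$a) + \<i> * of_real (t$a))" for a
    using c by (simp add: b_def t_def c_def flip: complex_eq)
  then have "cnj (Z$(Some a)) = cnj c * (of_real (b$a) - \<i> * of_real (t$a))" for a
    by simp
  then have tail: "tail Z = c *s (ovec b + \<i> *s ovec t)" "tail (cnj_vec Z) = cnj c *s (ovec b + (- \<i>) *s ovec t)"
    by (simp_all add: vec_eq_iff cnj_vec_def Z_Some algebra_simps)
  have cnj0: "cnj_vec Z $ None = cnj c"
    by (simp add: cnj_vec_def c_def)
  have "bil k Z Z (cnj_vec Z) = c * cnj c * Complex (tri k b b b / 6 - tri k b b b / 2 - tri k b t t) (- 2 / 3 * tri k t t t)"
    unfolding bil_eq[OF k Z tail(1)[unfolded c_def]] tail c_def[symmetric] cnj0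
    by (simp only: tri_add tri_scale) (simp add: tri_commute[OF k] tri_ovec Complex_eq field_simps)
  then show ?thesis
    unfolding complex_norm_square[symmetric]
    by (simp add: r_sq_bil[OF k Z] cubic_tri c_def[symmetric] t_def[symmetric])
qed

section \<open>Openness\<close>

definition base_pt :: "complex^('n::finite option) \<Rightarrow> complex^'n"
  where "base_pt Z = (\<chi> a. Z$(Some a) / Z$None)"

lemma cubic_scaleR: "cubic k (r *\<^sub>R t) = r^3 * cubic k t"
  using tri_scale[where k = k and c = r] by (simp add: cubic_tri scalar_mult_eq_scaleR power3_eq_cube)

lemma continuous_on_cubic: "continuous_on S (cubic k :: real^'n::finite \<Rightarrow> real)"
  unfolding cubic_def by (intro continuous_intros) auto

text \<open>As h is homogeneous of degree 3, the open ray through x meets {h = 1} exactly when h(x)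
  > 0, namely in x divided by the cube root of h(x). For an open T this describes the cone by open
  conditions.\<close>

lemma psr_cone_eq:
  assumes "H = {t. cubic k t = 1} \<inter> T"
  shows "psr_cone H = {t. cubic k t > 0 \<and> (1 / root 3 (cubic k t)) *\<^sub>R t \<in> T}"
proof (intro equalityI subsetI)
  fix x assume "x \<in> psr_cone H"
  then obtain r t where "x = r *\<^sub>R t" "r > 0" "cubic k t = 1" "t \<in> T"
    using assms by (auto simp: psr_cone_def)
  then show "x \<in> {t. cubic k t > 0 \<and> (1 / root 3 (cubic k t)) *\<^sub>R t \<in> T}"
    by (simp add: cubic_scaleR real_root_power_cancel)
next
  fix x assume x: "x \<in> {t. cubic k t > 0 \<and> (1 / root 3 (cubic k t)) *\<^sub>R t \<in> T}"
  define r where "r = root 3 (cubic k x)"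
  have r: "r > 0" "r^3 = cubic k x" using x by (simp_all add: r_def)
  moreover have "cubic k x > 0" using x by simp
  ultimately have "cubic k ((1 / r) *\<^sub>R x) = 1"
    by (simp add: cubic_scaleR power_divide)
  moreover have "x = r *\<^sub>R ((1 / r) *\<^sub>R x)" using r by simp
  ultimately show "x \<in> psr_cone H"
    unfolding psr_cone_def assms using r(1) x
    by (auto simp: r_def intro!: exI[of _ r] exI[of _ "(1 / r) *\<^sub>R x"])
qed

lemma cubic_pos: "psr_manifold k H \<Longrightarrow> t \<in> psr_cone H \<Longrightarrow> cubic k t > 0"
  by (auto simp: psr_manifold_def openin_open psr_cone_eq)

text \<open>Derivatives are taken in the ambient Euclidean space; openness makes them independent of
  values outside the domain, and \<open>M_set\<close> and \<open>N_tilde\<close> inherit it.\<close>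

lemma open_psr_cone:
  assumes "psr_manifold k H"
  shows "open (psr_cone H)"
proof -
  obtain T where T: "open T" "H = {t. cubic k t = 1} \<inter> T"
    using assms by (auto simp: psr_manifold_def openin_open)
  have "open {t::real^'a. cubic k t > 0}"
    using continuous_open_preimage[OF continuous_on_cubic[of UNIV k] open_UNIV, of "{0<..}"]
    by (simp add: vimage_def)
  moreover have "continuous_on {t::real^'a. cubic k t > 0} (\<lambda>t. (1 / root 3 (cubic k t)) *\<^sub>R t)"
    by (intro continuous_intros continuous_on_cubic) auto
  ultimately have "open ({t. cubic k t > 0} \<inter> (\<lambda>t. (1 / root 3 (cubic k t)) *\<^sub>R t) -` T)"
    using T(1) by (intro continuous_open_preimage)
  moreover have "\<dots> = psr_cone H"
    by (auto simp: psr_cone_eq[OF T(2)])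
  ultimately show ?thesis by simp
qed

lemma M_set_iff: "Z \<in> M_set H \<longleftrightarrow> Z$None \<noteq> 0 \<and> Im_vec (base_pt Z) \<in> psr_cone H"
proof
  assume "Z \<in> M_set H"
  then obtain c z where "Z = c *s hom z" "c \<noteq> 0" "z \<in> M_bar H"
    by (auto simp: M_set_def)
  moreover from this have "base_pt Z = z"
    by (simp add: base_pt_def hom_ocons vec_eq_iff)
  ultimately show "Z$None \<noteq> 0 \<and> Im_vec (base_pt Z) \<in> psr_cone H"
    by (simp add: M_bar_def hom_ocons)
next
  assume *: "Z$None \<noteq> 0 \<and> Im_vec (base_pt Z) \<in> psr_cone H"
  then have "Z = Z$None *s hom (base_pt Z)"
    by (intro ocons_eqI) (auto simp: hom_ocons base_pt_def vec_eq_iff)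
  with * show "Z \<in> M_set H"
    by (auto simp: M_set_def M_bar_def intro!: exI)
qed

text \<open>\<open>eta_form\<close> divides by r^2, so its smoothness and its cancellation against
  the factor r^2 in \<open>theta_3\<close> rest on this.\<close>

lemma r_sq_pos:
  assumes "psr_manifold k H" "Z \<in> M_set H"
  shows "r_sq k Z > 0"
proof -
  have "symmetric_coeffs k" using assms(1) by (simp add: psr_manifold_def)
  moreover have "Z$None \<noteq> 0" "cubic k (Im_vec (base_pt Z)) > 0"
    using assms by (auto simp: M_set_iff cubic_pos)
  ultimately show ?thesis
    by (simp add: r_sq_eq base_pt_def)
qed

lemma open_M_set:
  assumes "psr_manifold k H"
  shows "open (M_set H)"
proof -
  have "continuous_on {Z::complex^('a option). Z$None \<noteq> 0} (\<lambda>Z. Im_vec (base_pt Z))"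
    unfolding Im_vec_def base_pt_def by (intro continuous_intros) auto
  then have "open ({Z. Z$None \<noteq> 0} \<inter> (\<lambda>Z. Im_vec (base_pt Z)) -` psr_cone H)"
    by (intro continuous_open_preimage open_None_nz open_psr_cone[OF assms])
  moreover have "\<dots> = M_set H"
    by (auto simp: M_set_iff)
  ultimately show ?thesis by simp
qed

lemma open_N_tilde:
  assumes "psr_manifold k H"
  shows "open (N_tilde H)"
proof -
  have "N_tilde H = (- {(0, 0)}) \<times> M_set H \<times> UNIV"
    by (auto simp: N_tilde_def)
  then show ?thesis
    by (simp add: open_Times open_M_set[OF assms] open_Compl)
qed

section \<open>Integral curves\<close>

text \<open>The exponential of the linear vector field \<open>V3L\<close>, which is diagonal with
  frequencies 1, -1, -2 and 0.\<close>

definition flow :: "real \<Rightarrow> 'n::finite n_point \<Rightarrow> 'n n_point"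
  where "flow s = (\<lambda>((z, w), Z, \<zeta>). ((cis s * z, cis (- s) * w), cis (- 2 * s) *s Z, \<zeta>))"

lemma linear_ode_unique:
  fixes g :: "real \<Rightarrow> complex"
  assumes "\<And>s. (g has_vector_derivative \<i> * of_real a * g s) (at s)"
  shows "g s = cis (a * (s - s0)) * g s0"
proof -
  have "((\<lambda>s. cis (- a * s) * g s) has_vector_derivative 0) (at s)" for s
    using assms[of s] unfolding cis_conv_exp
    by (auto intro!: derivative_eq_intros has_vector_derivative_real_field simp: algebra_simps)
  then have "((\<lambda>s. cis (- a * s) * g s) has_derivative (\<lambda>_. 0)) (at s)" for s
    by (simp add: has_vector_derivative_def)
  then have "cis (- a * s) * g s = cis (- a * s0) * g s0"
    using has_derivative_zero_unique[of UNIV "\<lambda>s. cis (- a * s) * g s" s s0] by simp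
  then have "cis (a * s) * (cis (- a * s) * g s) = cis (a * s) * (cis (- a * s0) * g s0)"
    by simp
  then show ?thesis
    by (simp add: mult.assoc[symmetric] cis_mult right_diff_distrib)
qed

lemma integral_curve_flow:
  assumes "integral_curve H \<gamma>"
  shows "\<gamma> s = flow (s - s0) (\<gamma> s0)"
proof -
  have d: "(\<gamma> has_vector_derivative V3L (\<gamma> s)) (at s)" for s
    using assms by (simp add: integral_curve_def)
  have "bounded_linear (\<lambda>p::'a n_point. fst (fst p))" "bounded_linear (\<lambda>p::'a n_point. snd (fst p))"
    "bounded_linear (\<lambda>p::'a n_point. fst (snd p) $ i)" "bounded_linear (\<lambda>p::'a n_point. snd (snd p))" for i
    by (auto intro!: bounded_linear_intros bounded_linear_compose[OF bounded_linear_vec_nth])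
  note d' = this[THEN bounded_linear.has_vector_derivative, OF d]
  have "fst (fst (\<gamma> s)) = cis (1 * (s - s0)) * fst (fst (\<gamma> s0))"
    by (rule linear_ode_unique) (use d'(1) in \<open>simp add: V3L_def case_prod_beta\<close>)
  moreover have "snd (fst (\<gamma> s)) = cis ((- 1) * (s - s0)) * snd (fst (\<gamma> s0))"
    by (rule linear_ode_unique) (use d'(2) in \<open>simp add: V3L_def case_prod_beta\<close>)
  moreover have "fst (snd (\<gamma> s)) $ i = cis ((- 2) * (s - s0)) * fst (snd (\<gamma> s0)) $ i" for i
    by (rule linear_ode_unique) (use d'(3)[of i] in \<open>simp add: V3L_def case_prod_beta mult_ac\<close>)
  moreover have "snd (snd (\<gamma> s)) = snd (snd (\<gamma> s0))"
    by (rule has_derivative_zero_unique[of UNIV "\<lambda>s. snd (snd (\<gamma> s))"])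
      (use d'(4) in \<open>simp_all add: V3L_def case_prod_beta has_vector_derivative_def\<close>)
  ultimately show ?thesis
    by (simp add: flow_def case_prod_beta prod_eq_iff vec_eq_iff)
qed

lemma base_pt_scale: "c \<noteq> 0 \<Longrightarrow> base_pt (c *s Z) = base_pt Z"
  by (simp add: base_pt_def vec_eq_iff)

lemma flow_integral_curve:
  assumes "p \<in> N_tilde H"
  shows "integral_curve H (\<lambda>s. flow s p)"
proof -
  obtain z w Z \<zeta> where p: "p = ((z, w), Z, \<zeta>)" by (metis prod.exhaust)
  have "flow s p \<in> N_tilde H" for s
    using assms by (auto simp: p N_tilde_def flow_def M_set_iff base_pt_scale)
  moreover have "((\<lambda>s. flow s p) has_vector_derivative V3L (flow s p)) (at s)" for s
  proof -
    have c: "((\<lambda>s. cis (a * s) * c) has_vector_derivative \<i> * of_real a * (cis (a * s) * c)) (at s)" for a c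
      unfolding cis_conv_exp
      by (auto intro!: derivative_eq_intros has_vector_derivative_real_field simp: algebra_simps)
    have Z: "((\<lambda>s. cis (a * s) *s Z) has_vector_derivative (\<i> * of_real a) *s (cis (a * s) *s Z)) (at s)" for a
    proof -
      have *: "cis (a * s) *s Z = (\<Sum>i\<in>UNIV. axis i (cis (a * s) * Z$i))" for s
        by (simp add: vec_eq_iff axis_def if_distrib cong: if_cong)
      have **: "(\<i> * of_real a) *s (cis (a * s) *s Z) = (\<Sum>i\<in>UNIV. axis i (\<i> * of_real a * (cis (a * s) * Z$i)))"
        by (simp add: vec_eq_iff axis_def if_distrib mult.assoc cong: if_cong)
      have "bounded_linear (axis i :: complex \<Rightarrow> complex^('a option))" for i
        by (intro linear_conv_bounded_linear[THEN iffD1] linearI) (auto simp: vec_eq_iff axis_def)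
      then show ?thesis
        unfolding ** unfolding * by (intro has_vector_derivative_sum bounded_linear.has_vector_derivative[OF _ c])
    qed
    show ?thesis
      unfolding p flow_def V3L_def prod.case
      using c[of 1 z] c[of "-1" w] Z[of "-2"]
      by (auto intro!: has_vector_derivative_Pair simp: mult_ac)
  qed
  ultimately show ?thesis by (simp add: integral_curve_def)
qed

lemma flow_0: "flow 0 p = p"
  by (auto simp: flow_def split: prod.splits)

lemma cstar_act_N_tilde: "x \<noteq> 0 \<Longrightarrow> p \<in> N_tilde H \<longleftrightarrow> cstar_act x p \<in> N_tilde H"
  by (auto simp: cstar_act_def N_tilde_def split: prod.splits)

text \<open>Integral curves are flow lines, so two points of one curve differ by a flow time;
  conversely every flow line through \<open>N_tilde\<close> stays there and is a point of
  \<open>N_hat\<close>.\<close>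

lemma twistor_equiv_iff:
  "twistor_equiv H p q \<longleftrightarrow> p \<in> N_tilde H \<and> (\<exists>x s. x \<noteq> 0 \<and> q = flow s (cstar_act x p))"
proof
  assume "twistor_equiv H p q"
  then obtain x \<gamma> s0 s where "x \<noteq> 0" and \<gamma>: "integral_curve H \<gamma>" "cstar_act x p = \<gamma> s0" "q = \<gamma> s"
    by (auto simp: twistor_equiv_def N_hat_def)
  moreover have "\<gamma> s0 \<in> N_tilde H" using \<gamma>(1) by (simp add: integral_curve_def)
  ultimately show "p \<in> N_tilde H \<and> (\<exists>x s. x \<noteq> 0 \<and> q = flow s (cstar_act x p))"
    using integral_curve_flow[OF \<gamma>(1), of s s0] cstar_act_N_tilde[of x p H] by metis
next
  assume "p \<in> N_tilde H \<and> (\<exists>x s. x \<noteq> 0 \<and> q = flow s (cstar_act x p))"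
  then obtain x s where x: "x \<noteq> 0" "q = flow s (cstar_act x p)" and p: "p \<in> N_tilde H" by auto
  let ?C = "range (\<lambda>s. flow s (cstar_act x p))"
  have "?C \<in> N_hat H"
    using flow_integral_curve[of "cstar_act x p" H] p x(1) cstar_act_N_tilde[of x p H]
    by (auto simp: N_hat_def)
  moreover have "cstar_act x p \<in> ?C" "q \<in> ?C"
    using x(2) flow_0[of "cstar_act x p"] by (metis rangeI)+
  ultimately show "twistor_equiv H p q"
    using x(1) unfolding twistor_equiv_def by blast
qed

section \<open>Explicit form of the projection\<close>

text \<open>The factor |Z^0|/Z^0 is \<open>cis (- 2 * s)\<close> for a flow time s that turns Z^0
  into |Z^0|. In this time z and w turn by \<open>cis s\<close> and \<open>cis (- s)\<close>, so w/z
  acquires the same phase. All other coordinates are invariant under the flow.\<close>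

definition proj_coords ::
    "('n \<Rightarrow> 'n \<Rightarrow> 'n \<Rightarrow> real) \<Rightarrow> 'n::finite n_point \<Rightarrow> 'n z_point"
  where "proj_coords k = (\<lambda>((z, w), Z, (\<zeta>t, \<zeta>, \<sigma>)).
    ((base_pt Z, pi / 4 * f_fun k Z, (\<zeta>t, - \<zeta>, 4 * pi * \<sigma>)),
     if z = 0 then Infty else Fin (w / z * (of_real (cmod (Z$None)) / Z$None))))"

lemma f_fun_scale:
  assumes "symmetric_coeffs k" "Z$None \<noteq> 0" "c \<noteq> 0"
  shows "f_fun k (c *s Z) = (cmod c)\<^sup>2 * f_fun k Z"
proof -
  have "r_sq k (c *s Z) = (cmod c)\<^sup>2 * r_sq k Z"
    using assms base_pt_scale[of c Z] by (simp add: r_sq_eq flip: base_pt_def) (simp add: norm_mult power_mult_distrib)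
  then show ?thesis by (simp add: f_fun_def)
qed

lemma Arg_0_iff: "c \<noteq> 0 \<Longrightarrow> Arg c = 0 \<longleftrightarrow> c = of_real (cmod c)"
  by (metis Arg_of_real norm_ge_zero not_less rcis_cmod_Arg rcis_zero_arg)

text \<open>The description is meaningful because s and x drop out: every representative in the
  gauge has \<open>cis (- 2 * s)\<close> equal to |Z^0|/Z^0, and the factor x cancels in
  w/z.\<close>

lemma twistor_proj_eq:
  assumes k: "symmetric_coeffs k" and p: "p \<in> N_tilde H"
  shows "twistor_proj k H p = proj_coords k p"
proof -
  obtain z w Z \<zeta>t \<zeta> \<sigma> where p': "p = ((z, w), Z, \<zeta>t, \<zeta>, \<sigma>)" by (metis prod.exhaust)
  have Z: "Z$None \<noteq> 0" using p by (simp add: p' N_tilde_def M_set_iff)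
  have coords: "gauge_coords k q = proj_coords k p"
    if "twistor_equiv H p q" "Arg (fst (snd q) $ None) = 0" for q
  proof -
    from that(1) obtain x s where x: "x \<noteq> 0" and q: "q = flow s (cstar_act x p)"
      by (auto simp: twistor_equiv_iff)
    have q': "q = ((cis s * (x * z), cis (- s) * (x * w)), cis (- 2 * s) *s Z, \<zeta>t, \<zeta>, \<sigma>)"
      by (simp add: q p' flow_def cstar_act_def)
    have "cis (- 2 * s) * Z$None = of_real (cmod (Z$None))"
      using that(2) Z Arg_0_iff[of "cis (- 2 * s) * Z$None"] by (simp add: q' norm_mult)
    then have *: "cis (- (2 * s)) = of_real (cmod (Z$None)) / Z$None"
      using Z by (simp add: field_simps)
    have "cis (- s) / cis s = cis (- 2 * s)"
      by (simp add: cis_divide)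
    then have "cis (- s) * (x * w) / (cis s * (x * z)) = w / z * cis (- 2 * s)"
      using x by (metis (no_types, opaque_lifting) mult.commute mult_divide_mult_cancel_left times_divide_times_eq)
    then show ?thesis
      using x f_fun_scale[OF k Z, of "cis (- 2 * s)"] base_pt_scale[of "cis (- 2 * s)" Z]
      unfolding q' p' gauge_coords_def proj_coords_def
      by (simp add: base_pt_def[symmetric] del: mult_minus_left vector_smult_component) (simp add: base_pt_def * )
  qed
  \<comment> \<open>Half the argument, because the flow turns Z^0 with frequency -2; this supplies a
    representative in the gauge.\<close>
  define s where "s = Arg (Z$None) / 2"
  have "Z$None = of_real (cmod (Z$None)) * cis (2 * s)"
    using rcis_cmod_Arg[of "Z$None"] by (simp add: rcis_def s_def)
  then have "cis (- 2 * s) * Z$None = of_real (cmod (Z$None)) * (cis (- 2 * s) * cis (2 * s))"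
    by (metis mult.left_commute)
  also have "\<dots> = of_real (cmod (Z$None))"
    by (simp add: cis_mult)
  finally have "cis (- 2 * s) * Z$None = of_real (cmod (Z$None))" .
  then have "Arg (fst (snd (flow s (cstar_act 1 p))) $ None) = 0"
    by (simp add: p' flow_def cstar_act_def)
  moreover have "twistor_equiv H p (flow s (cstar_act 1 p))"
    using p unfolding twistor_equiv_iff by (metis one_neq_zero)
  ultimately show ?thesis
    unfolding twistor_proj_def using coords by (intro the_equality) metis+
qed

section \<open>Differentiability\<close>

text \<open>Serves to replace \<open>grad_F\<close>, \<open>hess_F\<close> and
  \<open>twistor_proj\<close>, given by limits or by a description, by closed formulas that are
  valid on an open set only.\<close>

lemma differentiable_transform_open:
  assumes "f differentiable (at x)" "open S" "x \<in> S" "\<And>y. y \<in> S \<Longrightarrow> f y = g y"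
  shows "g differentiable (at x)"
  using assms has_derivative_transform_within_open[where t = UNIV] unfolding differentiable_def by metis

lemma bounded_linear_axis: "bounded_linear (axis i :: 'b::euclidean_space \<Rightarrow> 'b^'m)"
  by (intro linear_conv_bounded_linear[THEN iffD1] linearI) (auto simp: vec_eq_iff axis_def)

lemma differentiable_vec_lambda:
  fixes f :: "'m::finite \<Rightarrow> 'a::real_normed_vector \<Rightarrow> 'b::euclidean_space"
  assumes "\<And>i. f i differentiable (at x)"
  shows "(\<lambda>x. \<chi> i. f i x) differentiable (at x)"
proof -
  have "(\<lambda>x. \<chi> i. f i x) = (\<lambda>x. \<Sum>i\<in>UNIV. axis i (f i x))"
    by (auto simp: vec_eq_iff axis_def if_distrib cong: if_cong)
  moreover have "(\<lambda>x. axis i (f i x)) differentiable (at x)" for i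
    by (rule differentiable_compose[of "axis i"])
      (auto intro: assms bounded_linear_imp_differentiable bounded_linear_axis)
  ultimately show ?thesis
    by (simp add: differentiable_sum)
qed

lemma differentiable_Pair:
  "f differentiable (at x) \<Longrightarrow> g differentiable (at x) \<Longrightarrow> (\<lambda>x. (f x, g x)) differentiable (at x)"
  unfolding differentiable_def by (blast intro: has_derivative_Pair)

lemma differentiable_bounded_linear:
  "bounded_linear f \<Longrightarrow> g differentiable (at x) \<Longrightarrow> (\<lambda>x. f (g x)) differentiable (at x)"
  by (rule differentiable_compose[of f]) (auto intro: bounded_linear_imp_differentiable)

lemmas differentiable_linears =
  bounded_linear_fst[THEN differentiable_bounded_linear] bounded_linear_snd[THEN differentiable_bounded_linear]
  bounded_linear_vec_nth[THEN differentiable_bounded_linear] bounded_linear_Re[THEN differentiable_bounded_linear]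
  bounded_linear_Im[THEN differentiable_bounded_linear] bounded_linear_of_real[THEN differentiable_bounded_linear]
  bounded_linear_cnj[THEN differentiable_bounded_linear] bounded_linear_minus[OF bounded_linear_ident, THEN differentiable_bounded_linear]

lemma differentiable_tri:
  fixes f g h :: "'b::real_normed_vector \<Rightarrow> complex^'n::finite"
  assumes "f differentiable (at x)" "g differentiable (at x)" "h differentiable (at x)"
  shows "(\<lambda>x. tri k (f x) (g x) (h x)) differentiable (at x)"
  unfolding tri_def
  by (intro differentiable_sum ballI differentiable_mult differentiable_const differentiable_linears(3) assms finite)

lemma differentiable_affine_part: "affine_part differentiable (at x)"
  unfolding affine_part_def
  by (intro differentiable_vec_lambda bounded_linear_imp_differentiable bounded_linear_vec_nth)

lemma differentiable_None: "(\<lambda>Z. Z $ None) differentiable (at x)"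
  by (intro bounded_linear_imp_differentiable bounded_linear_vec_nth)

lemma differentiable_grad_F:
  fixes Z :: "complex^('n::finite option)"
  assumes k: "symmetric_coeffs k" and Z: "Z$None \<noteq> 0"
  shows "(\<lambda>Z. grad_F k Z $ i) differentiable (at Z)"
proof -
  have "(\<lambda>Z. grad k Z i) differentiable (at Z)"
    unfolding grad_def cubic_tri using Z
    by (cases i) (auto intro!: differentiable_divide differentiable_linears differentiable_power differentiable_tri differentiable_affine_part
        differentiable_mult differentiable_const differentiable_None)
  then show ?thesis
    by (rule differentiable_transform_open[OF _ open_None_nz]) (use Z in \<open>auto simp: grad_F_eq[OF k]\<close>)
qed

lemma differentiable_hess_F:
  fixes Z :: "complex^('n::finite option)"
  assumes k: "symmetric_coeffs k" and Z: "Z$None \<noteq> 0"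
  shows "(\<lambda>Z. hess_F k Z $ i $ j) differentiable (at Z)"
proof -
  have "(\<lambda>Z. hess k Z i j) differentiable (at Z)"
    unfolding hess_def cubic_tri using Z
    by (cases i; cases j) (auto intro!: differentiable_divide differentiable_linears differentiable_power differentiable_tri differentiable_affine_part
        differentiable_mult differentiable_const differentiable_None)
  then show ?thesis
    by (rule differentiable_transform_open[OF _ open_None_nz]) (use Z in \<open>auto simp: hess_F_eq[OF k]\<close>)
qed

lemma differentiable_M_metric:
  fixes u v :: "complex^('n::finite option) \<Rightarrow> complex^('n option)"
  assumes "symmetric_coeffs k" "Z$None \<noteq> 0" "u differentiable (at Z)" "v differentiable (at Z)"
  shows "(\<lambda>Z. M_metric k Z (u Z) (v Z)) differentiable (at Z)"
  unfolding M_metric_def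
  by (intro differentiable_sum ballI differentiable_mult differentiable_linears differentiable_hess_F assms finite)

lemma differentiable_r_sq:
  assumes "symmetric_coeffs k" "Z$None \<noteq> 0"
  shows "r_sq k differentiable (at Z)"
  unfolding r_sq_def[abs_def]
  by (intro differentiable_M_metric assms differentiable_ident)

lemma differentiable_f_fun:
  assumes "symmetric_coeffs k" "Z$None \<noteq> 0"
  shows "f_fun k differentiable (at Z)"
  unfolding f_fun_def[abs_def]
  by (intro differentiable_mult differentiable_const differentiable_r_sq assms)

lemma differentiable_symp:
  fixes f g f' g' :: "'b::real_normed_vector \<Rightarrow> 'a::real_normed_field^'m::finite"
  assumes "\<And>i. (\<lambda>x. f x $ i) differentiable (at x)" "\<And>i. (\<lambda>x. g x $ i) differentiable (at x)"
    "\<And>i. (\<lambda>x. f' x $ i) differentiable (at x)" "\<And>i. (\<lambda>x. g' x $ i) differentiable (at x)"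
  shows "(\<lambda>x. symp (f x, g x) (f' x, g' x)) differentiable (at x)"
  unfolding symp_def fst_conv snd_conv
  by (intro differentiable_sum ballI differentiable_mult differentiable_diff assms finite)

text \<open>\<open>ext_deriv\<close> uses \<open>frechet_derivative\<close>, an arbitrary choice
  unless the function is differentiable; only with this fact does it compute the exterior derivative
  of \<lambda>~.\<close>

lemma differentiable_lambda_tilde:
  assumes psr: "psr_manifold k H" and p: "p \<in> N_tilde H"
  shows "(\<lambda>p. lambda_tilde k p v) differentiable (at p)"
proof -
  obtain dz dw dZ d\<zeta>t d\<zeta> d\<sigma> where v: "v = ((dz, dw), dZ, d\<zeta>t, d\<zeta>, d\<sigma>)" by (metis prod.exhaust)
  have k: "symmetric_coeffs k" using psr by (simp add: psr_manifold_def)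
  have "fst (snd p) \<in> M_set H" using p by (auto simp: N_tilde_def)
  then have Z: "fst (snd p) $ None \<noteq> 0" "r_sq k (fst (snd p)) \<noteq> 0"
    using r_sq_pos[OF psr, of "fst (snd p)"] by (auto simp: M_set_iff)
  have fs: "(\<lambda>p. f (fst (snd p))) differentiable (at p)"
    if "f differentiable (at (fst (snd p)))" for f :: "complex^('a option) \<Rightarrow> 'c::real_normed_vector"
    by (rule differentiable_compose[of f, where g = "\<lambda>p. fst (snd p)"])
      (rule that, intro differentiable_linears differentiable_ident)
  have 1: "(\<lambda>p. of_real (f_fun k (fst (snd p))) :: complex) differentiable (at p)"
    by (intro differentiable_linears(6) fs[OF differentiable_f_fun[OF k Z(1)]])
  have nth: "(\<lambda>Z. Z $ i) differentiable (at Z)" for Z :: "complex^('a option)" and i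
    by (intro differentiable_linears differentiable_ident)
  have 2: "(\<lambda>p. theta_plus k (fst (snd p)) (d\<zeta>t, d\<zeta>, d\<sigma>)) differentiable (at p)"
    unfolding theta_plus_def prod.case
    by (intro differentiable_minus differentiable_symp)
      (simp_all add: fs[OF differentiable_grad_F[OF k Z(1)]] fs[OF nth] differentiable_minus)
  have 3: "(\<lambda>p. theta_minus k (fst (snd p)) (d\<zeta>t, d\<zeta>, d\<sigma>)) differentiable (at p)"
    unfolding theta_minus_def prod.case
    by (intro differentiable_minus differentiable_symp)
      (simp_all add: cnj_vec_def fs[OF differentiable_grad_F[OF k Z(1)]] fs[OF nth] differentiable_minus differentiable_linears)
  have e: "(\<lambda>Z. eta_form k Z dZ) differentiable (at (fst (snd p)))"
    unfolding eta_form_def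
    by (intro differentiable_divide differentiable_M_metric differentiable_r_sq k Z differentiable_const
         linear_imp_differentiable linearI) (auto simp: vec_eq_iff algebra_simps)
  have 4: "(\<lambda>p. theta_3 k (snd p) (dZ, d\<zeta>t, d\<zeta>, d\<sigma>)) differentiable (at p)"
    unfolding theta_3_def case_prod_beta fst_conv snd_conv
    by (intro differentiable_add differentiable_diff differentiable_divide differentiable_mult
        differentiable_const differentiable_symp fs[OF e] fs[OF differentiable_r_sq[OF k Z(1)]] differentiable_linears differentiable_ident) auto
  show ?thesis
    unfolding lambda_tilde_def v case_prod_beta fst_conv snd_conv
    using 4 by (intro differentiable_mult differentiable_add differentiable_diff differentiable_const differentiable_power
        1 2 3 differentiable_linears differentiable_ident) simp
qed

lemma differentiable_base_pt:
  assumes "Z$None \<noteq> 0"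
  shows "base_pt differentiable (at Z)"
  unfolding base_pt_def[abs_def]
  by (intro differentiable_vec_lambda differentiable_divide differentiable_linears differentiable_ident assms)

text \<open>The second conclusion gives a neighbourhood whose image stays in the chart domain, so
  that the chart and its inverse cancel there in the chain rule.\<close>

lemma differentiable_proj:
  assumes psr: "psr_manifold k H" and p: "p \<in> N_tilde H" and c: "c \<in> cp1_charts"
    and pc: "snd (twistor_proj k H p) \<in> fst c"
  shows "(z_chart c \<circ> twistor_proj k H) differentiable (at p)"
    and "\<exists>S. open S \<and> p \<in> S \<and> S \<subseteq> N_tilde H \<and> (\<forall>q\<in>S. snd (twistor_proj k H q) \<in> fst c)"
proof -
  have k: "symmetric_coeffs k" using psr by (simp add: psr_manifold_def)
  have "fst (snd p) \<in> M_set H" using p by (auto simp: N_tilde_def)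
  then have Z: "fst (snd p) $ None \<noteq> 0" by (auto simp: M_set_iff)
  have open_fst: "open {q::'a n_point. fst (fst q) \<noteq> 0}" "open {q::'a n_point. snd (fst q) \<noteq> 0}"
    by (auto intro!: open_Collect_neq continuous_intros)
  have fs: "(\<lambda>p. f (fst (snd p))) differentiable (at p)"
    if "f differentiable (at (fst (snd p)))" for f :: "complex^('a option) \<Rightarrow> 'c::real_normed_vector"
    by (rule differentiable_compose[of f, where g = "\<lambda>p. fst (snd p)"])
      (rule that, intro differentiable_linears differentiable_ident)
  have base: "(\<lambda>p. (base_pt (fst (snd p)), pi / 4 * f_fun k (fst (snd p)), fst (snd (snd p)),
      - fst (snd (snd (snd p))), 4 * pi * snd (snd (snd (snd p))))) differentiable (at p)"
    by (intro differentiable_Pair fs[OF differentiable_base_pt[OF Z]] differentiable_mult differentiable_const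
        fs[OF differentiable_f_fun[OF k Z]] differentiable_linears differentiable_minus differentiable_ident)
  have cN: "(\<lambda>p::'a n_point. of_real (cmod (fst (snd p) $ None)) :: complex) differentiable (at p)"
    by (rule differentiable_linears(6), rule differentiable_compose[of cmod])
      (intro differentiable_norm_at Z, intro differentiable_linears differentiable_ident)
  have proj: "twistor_proj k H q = ((base_pt (fst (snd q)), pi / 4 * f_fun k (fst (snd q)), fst (snd (snd q)),
      - fst (snd (snd (snd q))), 4 * pi * snd (snd (snd (snd q)))),
      if fst (fst q) = 0 then Infty
      else Fin (snd (fst q) / fst (fst q) * (of_real (cmod (fst (snd q) $ None)) / fst (snd q) $ None)))"
    if "q \<in> N_tilde H" for q
    using twistor_proj_eq[OF k that] by (simp add: proj_coords_def case_prod_beta)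
  have N: "(fst q \<noteq> (0, 0)) \<and> fst (snd q) $ None \<noteq> 0" if "q \<in> N_tilde H" for q
    using that by (auto simp: N_tilde_def M_set_iff)
  from c consider "c = (- {Infty}, coord_t)" | "c = (- {Fin 0}, coord_inv_t)"
    by (auto simp: cp1_charts_def)
  then have "(z_chart c \<circ> twistor_proj k H) differentiable (at p) \<and>
    (\<exists>S. open S \<and> p \<in> S \<and> S \<subseteq> N_tilde H \<and> (\<forall>q\<in>S. snd (twistor_proj k H q) \<in> fst c))"
  proof cases
    case 1
    let ?S = "N_tilde H \<inter> {q. fst (fst q) \<noteq> 0}"
    have S: "open ?S" "p \<in> ?S"
      using open_N_tilde[OF psr] open_fst p pc by (auto simp: 1 proj split: if_splits)
    have "(\<lambda>q. snd (fst q) / fst (fst q) * (of_real (cmod (fst (snd q) $ None)) / fst (snd q) $ None)) differentiable (at p)"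
      by (intro differentiable_mult differentiable_divide differentiable_linears differentiable_ident cN Z) (use S in auto)
    note d = differentiable_Pair[OF base this]
    have "(z_chart c \<circ> twistor_proj k H) differentiable (at p)"
      by (rule differentiable_transform_open[OF d S]) (simp add: 1 z_chart_def proj)
    moreover have "\<forall>q\<in>?S. snd (twistor_proj k H q) \<in> fst c"
      by (simp add: 1 proj)
    ultimately show ?thesis using S by blast
  next
    case 2
    let ?S = "N_tilde H \<inter> {q. snd (fst q) \<noteq> 0}"
    have S: "open ?S" "p \<in> ?S"
      using open_N_tilde[OF psr] open_fst p pc N[OF p] by (auto simp: 2 proj prod_eq_iff split: if_splits)
    \<comment> \<open>The inverse of the expression for t. At z = 0 it vanishes, which is the value
      of \<open>coord_inv_t\<close> at \<open>Infty\<close>.\<close>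
    have "(\<lambda>q. fst (fst q) / snd (fst q) * (fst (snd q) $ None / of_real (cmod (fst (snd q) $ None)))) differentiable (at p)"
      by (intro differentiable_mult differentiable_divide differentiable_linears differentiable_ident cN Z) (use S Z in auto)
    note d = differentiable_Pair[OF base this]
    have "(z_chart c \<circ> twistor_proj k H) differentiable (at p)"
      by (rule differentiable_transform_open[OF d S]) (auto simp: 2 z_chart_def proj)
    moreover have "\<forall>q\<in>?S. snd (twistor_proj k H q) \<in> fst c"
      using N by (auto simp: 2 proj)
    ultimately show ?thesis using S by blast
  qed
  then show "(z_chart c \<circ> twistor_proj k H) differentiable (at p)"
    "\<exists>S. open S \<and> p \<in> S \<and> S \<subseteq> N_tilde H \<and> (\<forall>q\<in>S. snd (twistor_proj k H q) \<in> fst c)" by blast+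
qed

section \<open>Lifting the generators\<close>

lemma pair_rule_0 [simp]: "pair_rule k g (0, 0) = (0, 0)"
  using pair_rule_linear[of k g 0 1 0 0 0]
  by (cases g) (auto simp: vec_eq_iff ocons_def tri_def dot_def cov_def split: option.split)

lemma symp_linear:
  "symp (x + x', y + y') v = symp (x, y) v + symp (x', y') v"
  "symp v (x + x', y + y') = symp v (x, y) + symp v (x', y')"
  "symp (c *s x, c *s y) v = c * symp (x, y) v"
  by (simp_all add: symp_def algebra_simps sum.distrib sum_subtractf sum_distrib_left)

definition fibre_lin ::
    "('n \<Rightarrow> 'n \<Rightarrow> 'n \<Rightarrow> real) \<Rightarrow> 'n::finite L_gen \<Rightarrow> (real, 'n) fibre \<Rightarrow> (real, 'n) fibre"
  where "fibre_lin k g = (\<lambda>(x, y, s).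
    (fst (pair_rule k g (x, y)), Z_rule g y,
     multiplier g * s + symp (pair_rule k g (x, y)) (fst (translation g), fst (snd (translation g)))))"

lemma fibre_rule_affine: "valid_gen g \<Longrightarrow> fibre_rule k g \<zeta> = fibre_lin k g \<zeta> + translation g"
  by (cases \<zeta>, cases "translation g") (simp add: fibre_rule_eq fibre_lin_def)

lemma linear_Z_rule: "linear (Z_rule g :: 'a::{real_normed_field}^('n::finite option) \<Rightarrow> _)"
proof -
  have "(of_real r :: 'a) *s x = r *\<^sub>R x" for r and x :: "'a^'m"
    unfolding vec_eq_iff vector_scaleR_component by (simp add: scaleR_conv_of_real)
  note * = this
  have "Z_rule g (x + y) = Z_rule g x + Z_rule g y" for x y :: "'a^('n option)"
    by (cases g) (auto simp: vec_eq_iff ocons_def algebra_simps split: option.split)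
  moreover have "Z_rule g (r *\<^sub>R x) = r *\<^sub>R Z_rule g x" for r and x :: "'a^('n option)"
    using Z_rule_scale[of g "of_real r" x] by (simp add: * )
  ultimately show ?thesis by (intro linearI)
qed

lemma linear_fibre_lin: "linear (fibre_lin k g)"
proof (rule linearI)
  have P: "pair_rule k g (x + c *s x', y + c *s y') = (fst (pair_rule k g (x, y)) + c *s fst (pair_rule k g (x', y')), Z_rule g y + c *s Z_rule g y')"
    for x x' y y' and c :: real
    by (rule pair_rule_linear)
  have eta: "\<exists>X. pair_rule k g (x, y) = (X, Z_rule g y)" for x y :: "real^('a option)"
    by (metis prod.collapse snd_pair_rule)
  fix u v :: "(real, 'a) fibre"
  obtain x y s x' y' s' where uv: "u = (x, y, s)" "v = (x', y', s')" by (metis prod.exhaust)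
  obtain X X' where X: "pair_rule k g (x, y) = (X, Z_rule g y)" "pair_rule k g (x', y') = (X', Z_rule g y')"
    using eta by metis
  show "fibre_lin k g (u + v) = fibre_lin k g u + fibre_lin k g v"
    using P[of x 1 x' y y']
    by (simp add: linear_add[OF linear_Z_rule] uv fibre_lin_def symp_linear algebra_simps X)
  fix r :: real
  show "fibre_lin k g (r *\<^sub>R u) = r *\<^sub>R fibre_lin k g u"
    using P[of 0 r x 0 y] symp_linear(3)[of r]
    by (simp add: linear_scale[OF linear_Z_rule] linear_0[OF linear_Z_rule] uv fibre_lin_def algebra_simps scalar_mult_eq_scaleR X)
qed

text \<open>The passage from the coordinates (\<zeta>t', \<zeta>', \<sigma>') of P to those of the
  q-map space, as in \<open>gauge_coords\<close>.\<close>

definition flip :: "(real, 'n::finite) fibre \<Rightarrow> (real, 'n) fibre"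
  where "flip = (\<lambda>(x, y, s). (x, - y, 4 * pi * s))"

definition unflip :: "(real, 'n::finite) fibre \<Rightarrow> (real, 'n) fibre"
  where "unflip = (\<lambda>(x, y, s). (x, - y, s / (4 * pi)))"

lemma flip_unflip [simp]: "flip (unflip \<zeta>) = \<zeta>" "unflip (flip \<zeta>) = \<zeta>"
  by (simp_all add: flip_def unflip_def case_prod_beta)

lemma linear_flip: "linear flip" "linear unflip"
  by (auto intro!: linearI simp: flip_def unflip_def algebra_simps add_divide_distrib)

definition gen_lift ::
    "('n \<Rightarrow> 'n \<Rightarrow> 'n \<Rightarrow> real) \<Rightarrow> 'n::finite L_gen \<Rightarrow> 'n n_point \<Rightarrow> 'n n_point"
  where "gen_lift k g = (\<lambda>(q, Z, \<zeta>). (q, Z_rule g Z, unflip (fibre_rule k g (flip \<zeta>))))"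

definition gen_lift_lin ::
    "('n \<Rightarrow> 'n \<Rightarrow> 'n \<Rightarrow> real) \<Rightarrow> 'n::finite L_gen \<Rightarrow> 'n n_point \<Rightarrow> 'n n_point"
  where "gen_lift_lin k g = (\<lambda>(q, Z, \<zeta>). (q, Z_rule g Z, unflip (fibre_lin k g (flip \<zeta>))))"

text \<open>An injective affine map has an injective linear part, which in finite dimension is
  bijective. Thus the invertibility of the derivatives follows from that of the generators.\<close>

lemma affine_inj_has_derivative:
  fixes f A :: "'a::euclidean_space \<Rightarrow> 'a"
  assumes A: "linear A" and f: "\<And>x. f x = A x + b" and "inj f"
  shows "bij A" "(f has_derivative A) (at x)"
proof -
  have "inj A"
    using \<open>inj f\<close> f by (metis (no_types, lifting) injD injI)
  then show "bij A"
    using linear_injective_imp_surjective[OF A] by (simp add: bij_def)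
  have "(A has_derivative A) (at x)"
    using A by (simp add: linear_conv_bounded_linear bounded_linear_imp_has_derivative)
  then have "((\<lambda>x. A x + b) has_derivative A) (at x)"
    by (rule has_derivative_add_const)
  then show "(f has_derivative A) (at x)"
    using f by (metis (no_types, lifting) ext)
qed

lemma bij_gen_act: "valid_gen g \<Longrightarrow> bij (gen_act k g)"
  by (metis gen_act_inv gen_inv_inv valid_gen_inv bijI')

lemma gen_act_has_derivative:
  fixes g :: "'n::finite L_gen"
  assumes "valid_gen g"
  obtains D where "bij D" "\<And>p. (gen_act k g has_derivative D) (at p)"
proof -
  let ?D = "\<lambda>(z, \<rho>, \<zeta>). (base_rule g z - base_rule g 0, multiplier g * \<rho>, fibre_lin k g \<zeta>)"
  have "linear (\<lambda>z. base_rule g z - base_rule g 0)"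
    by (cases g) (auto intro!: linearI simp: scaleR_right_distrib)
  then have "linear ?D"
    using linear_fibre_lin[of k g]
    by (auto intro!: linearI simp: linear_add linear_scale algebra_simps)
      (auto simp: linear_iff algebra_simps)
  moreover have "gen_act k g p = ?D p + (base_rule g 0, 0, translation g)" for p
    using assms by (auto simp: gen_act_def rho_rule_multiplier fibre_rule_affine split: prod.split)
  moreover have "inj (gen_act k g)"
    using bij_gen_act[OF assms] by (rule bij_is_inj)
  ultimately show ?thesis
    using affine_inj_has_derivative[of ?D "gen_act k g"] that by blast
qed

lemma Z_rule_inv:
  fixes Z :: "'a::real_normed_field^('n::finite option)"
  shows "valid_gen g \<Longrightarrow> Z_rule (gen_inv g) (Z_rule g Z) = Z"
proof (cases g)
  case (Dil l)
  assume "valid_gen g"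
  then have "(1 / l) powr x * l powr x = 1" for x
    using Dil by (simp add: powr_divide)
  then have *: "(of_real ((1 / l) powr x) * (of_real (l powr x) * y) :: 'a) = y" for x y
    by (metis mult.assoc mult_1 of_real_1 of_real_mult)
  then show ?thesis
    unfolding Dil by (simp add: * vec_eq_iff ocons_def split: option.split)
next
  case (Heis r et e \<kappa>)
  assume "valid_gen g"
  then have "sqrt (1 / r) * sqrt r = 1"
    using Heis by (simp add: real_sqrt_divide)
  then have "(of_real (sqrt (1 / r)) * (of_real (sqrt r) * y) :: 'a) = y" for y
    by (metis mult.assoc mult_1 of_real_1 of_real_mult)
  then show ?thesis
    unfolding Heis by (simp add: vec_eq_iff)
qed (auto simp: ocons_def vec_eq_iff split: option.split)

lemma gen_lift_inv: "valid_gen g \<Longrightarrow> gen_lift k (gen_inv g) (gen_lift k g p) = p"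
  using gen_act_inv[of g k "(0, 0, flip (snd (snd p)))"]
  by (simp add: gen_lift_def gen_act_def Z_rule_inv case_prod_beta)

lemma bij_gen_lift: "valid_gen g \<Longrightarrow> bij (gen_lift k g)"
  by (metis gen_lift_inv gen_inv_inv valid_gen_inv bijI')

lemma gen_lift_has_derivative:
  assumes "valid_gen g"
  shows "bij (gen_lift_lin k g)" "(gen_lift k g has_derivative gen_lift_lin k g) (at p)"
proof -
  have A: "linear (\<lambda>\<zeta>. unflip (fibre_lin k g (flip \<zeta>)))"
    using linear_compose[OF linear_compose[OF linear_flip(1) linear_fibre_lin[of k g]] linear_flip(2)]
    by (simp add: comp_def)
  have "linear (gen_lift_lin k g)"
    by (intro linearI) (simp_all add: gen_lift_lin_def case_prod_beta linear_add[OF A] linear_scale[OF A]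
      linear_add[OF linear_Z_rule] linear_scale[OF linear_Z_rule])
  moreover have "gen_lift k g p = gen_lift_lin k g p + (0, 0, unflip (translation g))" for p
    using assms by (simp add: gen_lift_lin_def gen_lift_def fibre_rule_affine case_prod_beta linear_add[OF linear_flip(2)])
  ultimately show "bij (gen_lift_lin k g)" "(gen_lift k g has_derivative gen_lift_lin k g) (at p)"
    using affine_inj_has_derivative[of "gen_lift_lin k g" "gen_lift k g"] bij_is_inj[OF bij_gen_lift[OF assms]] by blast+
qed

text \<open>The factor s is sqrt r, l^(-3/2) or 1. Being real and positive it preserves the gauge
  Arg(Z^0) = 0. As h(l t) = l^3 h(t) and \<tau>_2 = sqrt(2\<rho>/h), the same factor governs
  \<tau>_2, which is what the Darboux coordinates require.\<close>

lemma Z_rule_hom_scale: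
  fixes g :: "'n::finite L_gen"
  assumes "valid_gen g"
  obtains s where "s > 0" "\<And>z. Z_rule g (hom z) = of_real s *s hom (base_rule g z)"
    "\<And>Z::complex^('n option). Z_rule g Z $ None = of_real s * Z $ None"
    "\<And>z \<rho>. z \<in> M_bar H \<Longrightarrow> tau2 k (base_rule g z) (rho_rule g \<rho>) = s * tau2 k z \<rho>"
proof (cases g)
  case (Heis r et e \<kappa>)
  show ?thesis
    by (rule that[of "sqrt r"])
      (use assms Heis in \<open>auto simp: tau2_def real_sqrt_mult[symmetric] algebra_simps\<close>)
next
  case (Dil l)
  define q where "q = l powr (1/2)"
  have q: "q > 0" "l powr (3/2) = q^3" "l powr (-3/2) = 1 / q^3" "l powr (-1/2) = 1 / q" "l = q * q"
    using assms Dil by (simp_all add: q_def powr_power powr_minus_divide flip: powr_add)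
  have sq: "sqrt (q^6) = q^3"
    using q(1) by (intro real_sqrt_unique) (simp_all flip: power_mult)
  have "Im_vec (l *\<^sub>R z) = l *\<^sub>R Im_vec z" for z :: "complex^'n"
    by (simp add: vec_eq_iff)
  then have tau2: "tau2 k (l *\<^sub>R z) \<rho> = 1 / q^3 * tau2 k z \<rho>" for z :: "complex^'n" and \<rho>
    using q(1) sq by (simp add: tau2_def cubic_scaleR real_sqrt_divide real_sqrt_mult q(5) power_mult_distrib)
  show ?thesis
  proof (rule that[of "1 / q^3"])
    show "1 / q^3 > 0" using q(1) by simp
    show "Z_rule g (hom z) = of_real (1 / q^3) *s hom (base_rule g z)" for z
    proof (rule ocons_eqI)
      have "l *\<^sub>R z = of_real (q * q) *s z"
        unfolding q(5) vec_eq_iff vector_scaleR_component by (simp add: scaleR_conv_of_real)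
      then show "tail (Z_rule g (hom z)) = tail (of_real (1 / q^3) *s hom (base_rule g z))"
        using q(1,4) by (simp add: Dil hom_ocons vec_eq_iff power3_eq_cube)
    qed (use q(3) in \<open>simp add: Dil hom_ocons\<close>)
    show "Z_rule g Z $ None = of_real (1 / q^3) * Z $ None" for Z :: "complex^('n option)"
      using q(3) by (simp add: Dil)
    show "tau2 k (base_rule g z) (rho_rule g \<rho>) = 1 / q^3 * tau2 k z \<rho>" for z \<rho>
      by (simp add: Dil tau2)
  qed
next
  case (Shift v)
  have "Im_vec (z + cvec v) = Im_vec z" for z :: "complex^'n"
    by (simp add: vec_eq_iff cvec_def)
  then show ?thesis
    by (intro that[of 1]) (auto intro!: ocons_eqI simp: Shift hom_ocons tau2_def cvec_ovec)
qed

lemma base_pt_eqI: "Z$None \<noteq> 0 \<Longrightarrow> Z = c *s hom z \<Longrightarrow> base_pt Z = z"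
  by (auto simp: base_pt_def hom_ocons vec_eq_iff)

lemma base_pt_Z_rule:
  assumes "valid_gen g" "Z$None \<noteq> 0"
  shows "base_pt (Z_rule g Z) = base_rule g (base_pt Z)"
proof -
  obtain s where s: "s > 0" "\<And>z. Z_rule g (hom z) = of_real s *s hom (base_rule g z)"
    "\<And>Z::complex^_. Z_rule g Z $ None = of_real s * Z $ None"
    using Z_rule_hom_scale[OF assms(1)] by metis
  have "Z = Z$None *s hom (base_pt Z)"
    using assms(2) by (intro ocons_eqI) (auto simp: hom_ocons base_pt_def vec_eq_iff)
  then have "Z_rule g Z = (Z$None * of_real s) *s hom (base_rule g (base_pt Z))"
    by (metis Z_rule_scale s(2) vector_smult_assoc)
  then show ?thesis
    by (rule base_pt_eqI[rotated]) (use s assms(2) in auto)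
qed

lemma M_set_Z_rule:
  assumes "valid_gen g" "Z \<in> M_set H"
  shows "Z_rule g Z \<in> M_set H"
proof -
  have Z: "Z$None \<noteq> 0" "base_pt Z \<in> M_bar H" using assms(2) by (auto simp: M_set_iff M_bar_def)
  then have "gen_act k g (base_pt Z, 1, 0) \<in> N_bar H" for k
    by (intro gen_act_N_bar[OF assms(1)]) (simp add: N_bar_def)
  then have "base_rule g (base_pt Z) \<in> M_bar H"
    by (simp add: gen_act_def N_bar_def)
  then show ?thesis
    using Z assms(1) by (simp add: M_set_iff M_bar_def base_pt_Z_rule Z_rule_nonzero)
qed

lemma gen_lift_N_tilde: "valid_gen g \<Longrightarrow> p \<in> N_tilde H \<Longrightarrow> gen_lift k g p \<in> N_tilde H"
  by (auto simp: N_tilde_def gen_lift_def M_set_Z_rule)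

text \<open>The phase |Z^0|/Z^0 ignores the positive factor s, so t is fixed; \<rho> = (pi/4) f is
  multiplied by the same number as r^2.\<close>

lemma twistor_proj_gen_lift:
  assumes k: "symmetric_coeffs k" and g: "valid_gen g" and p: "p \<in> N_tilde H"
  shows "twistor_proj k H (gen_lift k g p) = twistor_lift (gen_act k g) (twistor_proj k H p)"
proof -
  obtain z w Z \<zeta> where p': "p = ((z, w), Z, \<zeta>)" by (metis prod.exhaust)
  have Z: "Z$None \<noteq> 0" using p by (simp add: p' N_tilde_def M_set_iff)
  obtain s where s: "s > 0" "\<And>Z::complex^_. Z_rule g Z $ None = of_real s * Z $ None"
    using Z_rule_hom_scale[OF g] by metis
  have coords: "proj_coords k ((z, w), Z, \<zeta>) = ((base_pt Z, pi / 4 * f_fun k Z, flip \<zeta>),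
     if z = 0 then Infty else Fin (w / z * (of_real (cmod (Z$None)) / Z$None)))" for Z \<zeta>
    by (simp add: proj_coords_def flip_def split: prod.split)
  show ?thesis
    using s Z unfolding twistor_proj_eq[OF k p] twistor_proj_eq[OF k gen_lift_N_tilde[OF g p]]
    by (simp add: p' gen_lift_def coords twistor_lift_def gen_act_def base_pt_Z_rule[OF g Z] f_fun_def
        r_sq_Z_rule[OF k g Z] rho_rule_multiplier norm_mult)
qed

section \<open>Scaling of the contact form under the lifts\<close>

lemma pair_rule_ovec:
  "pair_rule k g (cvec x, cvec y) = (cvec (fst (pair_rule k g (x, y))), cvec (Z_rule g y))"
  unfolding cvec_ovec
  by (cases g; simp add: vec_eq_iff ocons_def tri_ovec cov_def dot_def tri_axis split: option.split)

text \<open>The coefficients of the linear part are real. This transfers the equivariance of (F,Z)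
  to its conjugate, which enters \<open>theta_minus\<close> and the terms with t in the Darboux
  coordinates.\<close>

lemma pair_rule_cnj:
  "pair_rule k g (cnj_vec x, cnj_vec y) = (cnj_vec (fst (pair_rule k g (x, y))), cnj_vec (Z_rule g y))"
proof (cases g)
  case (Shift v)
  have "tri k (ovec v) (ovec v) (tail (cnj_vec y)) = cnj (tri k (ovec v) (ovec v) (tail y))"
    by (simp add: tri_def cnj_vec_def)
  then show ?thesis
    unfolding Shift
    by (simp add: vec_eq_iff ocons_def cov_def dot_def tri_axis cnj_vec_def tri_ovec split: option.split)
qed (simp_all add: vec_eq_iff ocons_def cnj_vec_def split: option.split)

text \<open>The sign in Z' = (-F_i, Z^i) and the sign in \<zeta>'^i = -\<zeta>^i combine to the
  pairing with (F,Z), the vector that \<open>pair_rule_grad\<close> controls.\<close>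

lemma theta_unflip:
  "theta_plus k Z (unflip (x, y, s)) = - symp (grad_F k Z, Z) (cvec x, cvec y)"
  "theta_minus k Z (unflip (x, y, s)) = - symp (cnj_vec (grad_F k Z), cnj_vec Z) (cvec x, cvec y)"
  by (simp_all add: theta_plus_def theta_minus_def unflip_def symp_def cvec_def cnj_vec_def sum_negf[symmetric] algebra_simps)

text \<open>In the coordinates of the q-map space the fibre part becomes \<open>heis_form\<close>
  over 4 pi, and r^2 cancels in the part along M.\<close>

lemma theta_3_unflip:
  assumes "r_sq k Z \<noteq> 0"
  shows "theta_3 k (Z, unflip (x, y, s)) (dZ, unflip (dx, dy, ds))
    = (ds + symp (x, y) (dx, dy)) / (4 * pi) + pi * M_metric k Z (\<i> *s Z) dZ"
proof -
  have "symp (x, - y) (dx, - dy) = - symp (x, y) (dx, dy)"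
    by (simp add: symp_def sum_negf[symmetric] algebra_simps)
  then show ?thesis
    using assms by (simp add: theta_3_def unflip_def eta_form_def add_divide_distrib)
qed

text \<open>The coordinates z and w are untouched, and each of f, \<open>theta_plus\<close>,
  \<open>theta_minus\<close> and \<open>theta_3\<close> acquires the same factor.\<close>

lemma lambda_tilde_gen_lift:
  assumes psr: "psr_manifold k H" and g: "valid_gen g" and p: "p \<in> N_tilde H"
  shows "lambda_tilde k (gen_lift k g p) (gen_lift_lin k g u) = of_real (multiplier g) * lambda_tilde k p u"
proof -
  have k: "symmetric_coeffs k" using psr by (simp add: psr_manifold_def)
  obtain z w Z \<zeta> where p': "p = ((z, w), Z, \<zeta>)" by (metis prod.exhaust)
  obtain dz dw dZ d\<zeta> where u: "u = ((dz, dw), dZ, d\<zeta>)" by (metis prod.exhaust)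
  obtain x y s where \<zeta>: "\<zeta> = unflip (x, y, s)" by (metis flip_unflip(2) prod.exhaust)
  obtain dx dy ds where d\<zeta>: "d\<zeta> = unflip (dx, dy, ds)" by (metis flip_unflip(2) prod.exhaust)
  obtain et e \<kappa> where tr: "translation g = (et, e, \<kappa>)" by (metis prod.exhaust)
  have "Z \<in> M_set H" using p by (simp add: p' N_tilde_def)
  then have Z: "Z$None \<noteq> 0" and r: "r_sq k Z \<noteq> 0" "r_sq k (Z_rule g Z) \<noteq> 0"
    using r_sq_pos[OF psr, of Z] r_sq_pos[OF psr M_set_Z_rule[OF g], of Z] by (auto simp: M_set_iff)
  define X where "X = fst (pair_rule k g (x, y))"
  define dX where "dX = fst (pair_rule k g (dx, dy))"
  have P: "pair_rule k g (x, y) = (X, Z_rule g y)" "pair_rule k g (dx, dy) = (dX, Z_rule g dy)"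
    unfolding X_def dX_def by (metis prod.collapse snd_pair_rule)+
  have PF: "pair_rule k g (grad_F k Z, Z) = (grad_F k (Z_rule g Z), Z_rule g Z)"
    using pair_rule_grad[OF k g Z] by (metis prod.collapse snd_pair_rule)
  have PFc: "pair_rule k g (cnj_vec (grad_F k Z), cnj_vec Z) = (cnj_vec (grad_F k (Z_rule g Z)), cnj_vec (Z_rule g Z))"
    by (simp add: pair_rule_cnj PF)
  have Pd: "pair_rule k g (cvec dx, cvec dy) = (cvec dX, cvec (Z_rule g dy))"
    by (simp add: pair_rule_ovec P)
  note sP = symp_pair_rule[OF k g]
  have lift: "gen_lift k g p = ((z, w), Z_rule g Z, unflip (X + et, Z_rule g y + e, \<kappa> + multiplier g * s + symp (X, Z_rule g y) (et, e)))"
    by (simp add: gen_lift_def p' \<zeta> fibre_rule_eq[OF g tr] P)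
  have lin: "gen_lift_lin k g u = ((dz, dw), Z_rule g dZ, unflip (dX, Z_rule g dy, multiplier g * ds + symp (dX, Z_rule g dy) (et, e)))"
    by (simp add: gen_lift_lin_def u d\<zeta> fibre_lin_def P tr)
  \<comment> \<open>The translation enters twice: through d\<sigma>, as the pairing of P d\<zeta>
    with it, and through the term pairing \<zeta> with d\<zeta>, in the opposite order. The two
    contributions cancel.\<close>
  have "symp (et, e) (dX, Z_rule g dy) = - symp (dX, Z_rule g dy) (et, e)"
    by (simp add: symp_def sum_negf[symmetric] algebra_simps)
  then have "symp (X + et, Z_rule g y + e) (dX, Z_rule g dy) = multiplier g * symp (x, y) (dx, dy) - symp (dX, Z_rule g dy) (et, e)"
    using sP[of x y dx dy] by (simp add: symp_linear P)
  then have 3: "theta_3 k (Z_rule g Z, unflip (X + et, Z_rule g y + e, \<kappa> + multiplier g * s + symp (X, Z_rule g y) (et, e)))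
     (Z_rule g dZ, unflip (dX, Z_rule g dy, multiplier g * ds + symp (dX, Z_rule g dy) (et, e)))
     = multiplier g * theta_3 k (Z, \<zeta>) (dZ, d\<zeta>)"
    unfolding \<zeta> d\<zeta> theta_3_unflip[OF r(1)] theta_3_unflip[OF r(2)] Z_rule_scale[symmetric] M_metric_Z_rule[OF k g Z]
    by (simp add: algebra_simps add_divide_distrib)
  have 1: "theta_plus k (Z_rule g Z) (unflip (dX, Z_rule g dy, t)) = of_real (multiplier g) * theta_plus k Z d\<zeta>" for t
    using sP[of "grad_F k Z" Z "cvec dx" "cvec dy"] by (simp add: d\<zeta> theta_unflip PF Pd)
  have 2: "theta_minus k (Z_rule g Z) (unflip (dX, Z_rule g dy, t)) = of_real (multiplier g) * theta_minus k Z d\<zeta>" for t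
    using sP[of "cnj_vec (grad_F k Z)" "cnj_vec Z" "cvec dx" "cvec dy"] by (simp add: d\<zeta> theta_unflip PFc Pd)
  show ?thesis
    unfolding lift lin unfolding p' u
    unfolding lambda_tilde_def prod.case 1 2 3 f_fun_def r_sq_Z_rule[OF k g Z]
    by (simp add: algebra_simps)
qed

section \<open>Transformation of the Darboux coordinates\<close>

lemma cnj_vec_scale: "cnj_vec (c *s x) = cnj c *s cnj_vec x"
  by (simp add: cnj_vec_def vec_eq_iff)

lemma grad_F_scale:
  assumes "symmetric_coeffs k" "Z$None \<noteq> 0" "c \<noteq> 0"
  shows "grad_F k (c *s Z) = c *s grad_F k Z"
  using assms by (simp add: grad_F_ocons cov_linear tri_scale vec_eq_iff ocons_def power2_eq_square split: option.split)

text \<open>The Darboux coordinates arise from (\<zeta>t, \<zeta>, \<sigma>) by a complex Heisenberg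
  translation: the pair is moved by a combination (X,Y) of (F,Z) and its conjugate, and \<sigma> by
  the pairing of (X,Y) with (\<zeta>t, \<zeta>).\<close>

lemma darboux_fin:
  "darboux k ((z, \<rho>, x, y, s), Fin t) = (let c = \<i> * of_real (tau2 k z \<rho>) / 2;
     F = grad_F k (hom z); a = - c * inverse t; b = - c * t;
     X = a *s F + b *s cnj_vec F; Y = a *s hom z + b *s cnj_vec (hom z)
   in (cvec x + X, cvec y + Y, of_real s + symp (X, Y) (cvec x, cvec y)))"
  by (simp add: darboux_def Let_def symp_linear vec_eq_iff cvec_def cnj_vec_def algebra_simps)

text \<open>P maps the complex translation vector at a point to the one at its image: the factor r
  in P (F,Z) = r (F',Z') is exactly the change of \<tau>_2. As P scales the pairing by the
  multiplier, the rule then carries over from (\<zeta>t, \<zeta>, \<sigma>).\<close>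

lemma darboux_gen_act:
  assumes psr: "psr_manifold k H" and g: "valid_gen g" and p: "p \<in> N_bar H"
  shows "darboux k (gen_act k g p, Fin t) = fibre_rule k g (darboux k (p, Fin t))"
proof -
  have k: "symmetric_coeffs k" using psr by (simp add: psr_manifold_def)
  obtain z \<rho> x y s where p': "p = (z, \<rho>, x, y, s)" by (metis prod.exhaust)
  have z: "z \<in> M_bar H" using p by (simp add: p' N_bar_def)
  obtain et e \<kappa> where tr: "translation g = (et, e, \<kappa>)" by (metis prod.exhaust)
  obtain r where r: "r > 0" "\<And>z. Z_rule g (hom z) = of_real r *s hom (base_rule g z)"
    "\<And>z \<rho>. z \<in> M_bar H \<Longrightarrow> tau2 k (base_rule g z) (rho_rule g \<rho>) = r * tau2 k z \<rho>"
    using Z_rule_hom_scale[OF g] by metis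
  define F where "F = grad_F k (hom z)"
  define F' where "F' = grad_F k (hom (base_rule g z))"
  define Z' where "Z' = hom (base_rule g z)"
  define c where "c = \<i> * of_real (tau2 k z \<rho>) / 2"
  define a where "a = - c * inverse t"
  define b where "b = - c * t"
  define X where "X = a *s F + b *s cnj_vec F"
  define Y where "Y = a *s hom z + b *s cnj_vec (hom z)"
  define X' where "X' = (a * of_real r) *s F' + (b * of_real r) *s cnj_vec F'"
  define Y' where "Y' = (a * of_real r) *s Z' + (b * of_real r) *s cnj_vec Z'"
  define x' where "x' = fst (pair_rule k g (x, y))"
  have hom: "hom z $ None \<noteq> 0" "Z' $ None \<noteq> 0" for z :: "complex^'a"
    by (simp_all add: hom_ocons Z'_def)
  have PF: "pair_rule k g (F, hom z) = (of_real r *s F', of_real r *s Z')"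
    using pair_rule_grad[OF k g hom(1)[of z]] snd_pair_rule[of k g F "hom z"] r(1)
      grad_F_scale[OF k hom(2), of "of_real r"]
    by (simp add: prod_eq_iff F_def r(2) F'_def Z'_def)
  have PFc: "pair_rule k g (cnj_vec F, cnj_vec (hom z)) = (of_real r *s cnj_vec F', of_real r *s cnj_vec Z')"
    by (simp add: pair_rule_cnj PF cnj_vec_scale r(2) Z'_def)
  have PX: "pair_rule k g (X, Y) = (X', Y')"
  proof -
    have "pair_rule k g (0 + a *s F, 0 + a *s hom z) = (a *s (of_real r *s F'), a *s (of_real r *s Z'))"
      unfolding pair_rule_linear by (simp add: PF linear_0[OF linear_Z_rule] r(2) Z'_def)
    then have "pair_rule k g (a *s F, a *s hom z) = (a *s (of_real r *s F'), a *s (of_real r *s Z'))"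
      by simp
    moreover from this have "Z_rule g (a *s hom z) = a *s (of_real r *s Z')"
      by (metis snd_conv snd_pair_rule)
    moreover have "Z_rule g (cnj_vec (hom z)) = of_real r *s cnj_vec Z'"
      by (metis PFc snd_conv snd_pair_rule)
    ultimately show ?thesis
      unfolding X_def Y_def pair_rule_linear by (simp add: PFc X'_def Y'_def)
  qed
  have ZY: "Z_rule g Y = Y'" by (metis PX snd_conv snd_pair_rule)
  have Px: "pair_rule k g (cvec x, cvec y) = (cvec x', cvec (Z_rule g y))"
    by (simp add: pair_rule_ovec x'_def)
  have Zy: "Z_rule g (cvec y) = cvec (Z_rule g y)" by (metis Px snd_conv snd_pair_rule)
  have P: "pair_rule k g (cvec x + X, cvec y + Y) = (cvec x' + X', cvec (Z_rule g y) + Y')"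
    using pair_rule_linear[of k g "cvec x" 1 X "cvec y" Y] by (simp add: Px PX ZY Zy)
  have Pr: "pair_rule k g (x, y) = (x', Z_rule g y)"
    unfolding x'_def by (metis prod.collapse snd_pair_rule)
  have inv: "symp (X', Y') (cvec x', cvec (Z_rule g y)) = of_real (multiplier g) * symp (X, Y) (cvec x, cvec y)"
    using symp_pair_rule[OF k g, of X Y "cvec x" "cvec y"] by (simp add: PX Px)
  have cv: "cvec (u + v) = cvec u + cvec v" for u v :: "real^'m"
    by (simp add: cvec_def vec_eq_iff)
  have sy: "of_real (symp (u, v) (u', v')) = symp (cvec u, cvec v) (cvec u', cvec v')" for u v u' v' :: "real^'a option"
    by (simp add: symp_def cvec_def)
  have D: "darboux k (p, Fin t) = (cvec x + X, cvec y + Y, of_real s + symp (X, Y) (cvec x, cvec y))"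
    by (simp add: p' darboux_fin Let_def X_def Y_def F_def a_def b_def c_def)
  have act: "gen_act k g p = (base_rule g z, rho_rule g \<rho>, x' + et, Z_rule g y + e, \<kappa> + multiplier g * s + symp (x', Z_rule g y) (et, e))"
    by (simp add: p' gen_act_def fibre_rule_eq[OF g tr] Pr)
  have "darboux k (gen_act k g p, Fin t) = (cvec (x' + et) + X', cvec (Z_rule g y + e) + Y',
      of_real (\<kappa> + multiplier g * s + symp (x', Z_rule g y) (et, e)) + symp (X', Y') (cvec (x' + et), cvec (Z_rule g y + e)))"
    unfolding act darboux_fin Let_def r(3)[OF z]
    by (simp add: X'_def Y'_def F'_def Z'_def a_def b_def c_def mult_ac)
  also have "\<dots> = fibre_rule k g (darboux k (p, Fin t))"
    unfolding D fibre_rule_eq[OF g tr] P linear_add[OF linear_Z_rule] Zy ZY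
    by (simp add: cv sy symp_linear inv cvec_ovec[symmetric] algebra_simps)
  finally show ?thesis .
qed

lemma word_act_N_bar: "w \<in> L_words \<Longrightarrow> p \<in> N_bar H \<Longrightarrow> word_act k w p \<in> N_bar H"
  by (induction w) (auto simp: L_words_def gen_act_N_bar)

lemma darboux_word_act:
  assumes "psr_manifold k H" "w \<in> L_words" "p \<in> N_bar H"
  shows "darboux k (twistor_lift (word_act k w) (p, Fin t)) = word_rule k w (darboux k (p, Fin t))"
  using assms(2)
proof (induction w)
  case (Cons g w)
  then have "valid_gen g" "w \<in> L_words" by (auto simp: L_words_def)
  then show ?case
    using Cons.IH darboux_gen_act[OF assms(1) \<open>valid_gen g\<close> word_act_N_bar[OF _ assms(3)]]
    by (simp add: twistor_lift_def)
qed (simp add: twistor_lift_def)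

section \<open>Contact automorphisms\<close>

lemma bij_image_eqI: "bij f \<Longrightarrow> (\<And>x. f x \<in> B \<longleftrightarrow> x \<in> A) \<Longrightarrow> f ` A = B"
  by (metis bij_is_surj image_vimage_eq inf_top.right_neutral set_eqI vimage_eq)

text \<open>What the invariance arguments use of a lift: \<Phi> on \<open>N_tilde\<close> covers
  \<phi> and multiplies \<lambda>~ by the constant m. The derivatives D and L are the same at all
  points because the maps are affine. In this form the data compose, so an induction over words
  reduces everything to generators.\<close>

locale contact_lift =
  fixes k :: "'n::finite \<Rightarrow> 'n \<Rightarrow> 'n \<Rightarrow> real" and H :: "(real^'n) set"
    and \<phi> D :: "'n q_point \<Rightarrow> 'n q_point" and \<Phi> L :: "'n n_point \<Rightarrow> 'n n_point" and m :: real
  assumes psr: "psr_manifold k H"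
    and bij: "bij \<phi>" "bij D" "bij \<Phi>" "bij L"
    and \<phi>_deriv: "(\<phi> has_derivative D) (at p)"
    and \<Phi>_deriv: "(\<Phi> has_derivative L) (at q)"
    and \<phi>_N_bar: "p \<in> N_bar H \<Longrightarrow> \<phi> p \<in> N_bar H"
    and \<Phi>_N_tilde: "\<Phi> q \<in> N_tilde H \<longleftrightarrow> q \<in> N_tilde H"
    and m: "m \<noteq> 0"
    and lambda: "q \<in> N_tilde H \<Longrightarrow> lambda_tilde k (\<Phi> q) (L u) = of_real m * lambda_tilde k q u"
    and proj: "q \<in> N_tilde H \<Longrightarrow> twistor_proj k H (\<Phi> q) = twistor_lift \<phi> (twistor_proj k H q)"

lemma contact_lift_id: "psr_manifold k H \<Longrightarrow> contact_lift k H id id id id 1"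
  by unfold_locales (auto simp: twistor_lift_def prod.map_id)

lemma contact_lift_comp:
  assumes "contact_lift k H \<phi> D \<Phi> L m" "contact_lift k H \<phi>' D' \<Phi>' L' m'"
  shows "contact_lift k H (\<phi> \<circ> \<phi>') (D \<circ> D') (\<Phi> \<circ> \<Phi>') (L \<circ> L') (m * m')"
proof -
  interpret a: contact_lift k H \<phi> D \<Phi> L m by fact
  interpret b: contact_lift k H \<phi>' D' \<Phi>' L' m' by fact
  show ?thesis
  proof
    show "(\<phi> \<circ> \<phi>' has_derivative D \<circ> D') (at p)" for p
      by (rule diff_chain_at[OF b.\<phi>_deriv a.\<phi>_deriv])
    show "(\<Phi> \<circ> \<Phi>' has_derivative L \<circ> L') (at p)" for p
      by (rule diff_chain_at[OF b.\<Phi>_deriv a.\<Phi>_deriv])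
  qed (auto simp: a.psr a.\<phi>_N_bar b.\<phi>_N_bar a.\<Phi>_N_tilde b.\<Phi>_N_tilde a.m b.m a.lambda b.lambda a.proj b.proj
      twistor_lift_def prod.map_comp intro: bij_comp a.bij b.bij)
qed

lemma contact_lift_gen:
  assumes psr: "psr_manifold k H" and g: "valid_gen g"
  shows "\<exists>D. contact_lift k H (gen_act k g) D (gen_lift k g) (gen_lift_lin k g) (multiplier g)"
proof -
  obtain D where D: "bij D" "\<And>p. (gen_act k g has_derivative D) (at p)"
    using gen_act_has_derivative[OF g] by metis
  have k: "symmetric_coeffs k" using psr by (simp add: psr_manifold_def)
  have "contact_lift k H (gen_act k g) D (gen_lift k g) (gen_lift_lin k g) (multiplier g)"
  proof
    show "gen_lift k g q \<in> N_tilde H \<longleftrightarrow> q \<in> N_tilde H" for q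
      using gen_lift_N_tilde[OF g, of q H k] gen_lift_N_tilde[OF valid_gen_inv[OF g], of "gen_lift k g q" H k]
      by (auto simp: gen_lift_inv[OF g])
  qed (use psr D bij_gen_act[OF g] bij_gen_lift[OF g] gen_lift_has_derivative[OF g] gen_act_N_bar[OF g]
      multiplier_pos[OF g] lambda_tilde_gen_lift[OF psr g] twistor_proj_gen_lift[OF k g] in auto)
  then show ?thesis by blast
qed

lemma contact_lift_word:
  assumes "psr_manifold k H" "w \<in> L_words"
  shows "\<exists>D \<Phi> L m. contact_lift k H (word_act k w) D \<Phi> L m"
  using assms(2)
proof (induction w)
  case Nil
  show ?case unfolding word_act.simps using contact_lift_id[OF assms(1)] by blast
next
  case (Cons g w)
  then have "valid_gen g" "w \<in> L_words" by (auto simp: L_words_def)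
  then show ?case
    using Cons.IH contact_lift_gen[OF assms(1)] contact_lift_comp unfolding word_act.simps by metis
qed

section \<open>The two charts of the projective line\<close>

lemma cp1_chart_inv: "c \<in> cp1_charts \<Longrightarrow> s \<in> fst c \<Longrightarrow> inv_into (fst c) (snd c) (snd c s) = s"
proof (rule inv_into_f_f)
  assume "c \<in> cp1_charts"
  moreover have "inj_on coord_t (- {Infty})" "inj_on coord_inv_t (- {Fin 0})"
    unfolding inj_on_def by (metis ComplD cp1.exhaust coord_t.simps(1) insertI1)
      (metis ComplD cp1.exhaust coord_inv_t.simps insertI1 inverse_inverse_eq inverse_zero)
  ultimately show "inj_on (snd c) (fst c)" by (auto simp: cp1_charts_def)
qed

text \<open>The lift is the identity on the projective line, so there its expression in the charts c
  and c' is the transition map, the identity or the inversion. The nonzero derivative makes the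
  differential of the lift bijective.\<close>

lemma cp1_transition:
  assumes "c \<in> cp1_charts" "c' \<in> cp1_charts" "s \<in> fst c" "s \<in> fst c'"
  shows "\<exists>a. a \<noteq> 0 \<and> ((snd c' \<circ> inv_into (fst c) (snd c)) has_field_derivative a) (at (snd c s))"
proof -
  have t: "inv_into (- {Infty}) coord_t u = Fin u" for u
    using cp1_chart_inv[of "(- {Infty}, coord_t)" "Fin u"] by (simp add: cp1_charts_def)
  have u: "inv_into (- {Fin 0}) coord_inv_t u = (if u = 0 then Infty else Fin (inverse u))" for u
    using cp1_chart_inv[of "(- {Fin 0}, coord_inv_t)" Infty]
      cp1_chart_inv[of "(- {Fin 0}, coord_inv_t)" "Fin (inverse u)"] by (auto simp: cp1_charts_def)
  have tt: "coord_t \<circ> inv_into (- {Infty}) coord_t = (\<lambda>u. u)"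
    "coord_inv_t \<circ> inv_into (- {Fin 0}) coord_inv_t = (\<lambda>u. u)"
    "coord_inv_t \<circ> inv_into (- {Infty}) coord_t = inverse"
    "coord_t \<circ> inv_into (- {Fin 0}) coord_inv_t = inverse"
    by (auto simp: t u fun_eq_iff)
  have inv: "\<exists>a. a \<noteq> 0 \<and> (inverse has_field_derivative a) (at u)" if "u \<noteq> 0" for u :: complex
    using DERIV_inverse[OF that] that by (intro exI[of _ "- (inverse u ^ Suc (Suc 0))"]) simp
  have id: "\<exists>a. a \<noteq> 0 \<and> ((\<lambda>u. u) has_field_derivative a) (at u)" for u :: complex
    using DERIV_ident by (intro exI[of _ 1]) simp
  have nz: "s \<noteq> Infty \<Longrightarrow> s \<noteq> Fin 0 \<Longrightarrow> coord_t s \<noteq> 0 \<and> coord_inv_t s \<noteq> 0"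
    by (cases s) auto
  show ?thesis
    using assms inv id nz unfolding cp1_charts_def by (auto simp: tt)
qed

section \<open>Invariance of the complex structure and of the contact distribution\<close>

context contact_lift
begin

lemma differential:
  assumes c: "c \<in> cp1_charts" "c' \<in> cp1_charts" and x: "snd x \<in> fst c" "snd x \<in> fst c'"
  shows "\<exists>A. bij A \<and> has_differential (twistor_lift \<phi>) c c' x A"
proof -
  obtain a where a: "a \<noteq> 0" "((snd c' \<circ> inv_into (fst c) (snd c)) has_field_derivative a) (at (snd c (snd x)))"
    using cp1_transition[OF c x] by blast
  let ?T = "snd c' \<circ> inv_into (fst c) (snd c)"
  have eq: "z_chart c' \<circ> twistor_lift \<phi> \<circ> z_chart_inv c = (\<lambda>y. (\<phi> (fst y), ?T (snd y)))"
    by (simp add: fun_eq_iff z_chart_def twistor_lift_def z_chart_inv_def)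
  have T: "(?T has_derivative (*) a) (at (snd (z_chart c x)))"
    using a(2) by (simp add: has_field_derivative_def z_chart_def)
  have "((\<lambda>y. (\<phi> (fst y), ?T (snd y))) has_derivative (\<lambda>y. (D (fst y), a * snd y))) (at (z_chart c x))"
    by (intro has_derivative_Pair has_derivative_compose[OF has_derivative_fst[OF has_derivative_ident] \<phi>_deriv]
      has_derivative_compose[OF has_derivative_snd[OF has_derivative_ident] T])
  moreover have "bij (\<lambda>y. (D (fst y), a * snd y))"
  proof (rule bijI)
    show "inj (\<lambda>y. (D (fst y), a * snd y))"
      using bij(2) a(1) by (auto simp: inj_on_def bij_def)
    show "surj (\<lambda>y. (D (fst y), a * snd y))"
    proof (rule surjI)
      fix y show "(D (fst (inv D (fst y), snd y / a)), a * snd (inv D (fst y), snd y / a)) = y"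
        using bij(2) a(1) by (simp add: bij_def surj_f_inv_f)
    qed
  qed
  ultimately show ?thesis
    unfolding has_differential_def eq by blast
qed

lemma fibre_iff: "\<Phi> p \<in> twistor_fibre k H (twistor_lift \<phi> x) \<longleftrightarrow> p \<in> twistor_fibre k H x"
proof -
  have "inj (twistor_lift \<phi>)"
    using bij(1) by (auto simp: twistor_lift_def inj_on_def bij_def)
  then show ?thesis
    by (auto simp: twistor_fibre_def \<Phi>_N_tilde proj inj_eq)
qed

text \<open>The map sending q to the class of \<Phi> q in the chart c' is differentiated in two
  ways, through \<Phi> upstairs and through the lift downstairs. The two composites agree near p, so
  uniqueness of the derivative applies.\<close>

lemma d_proj_lift:
  assumes c: "c \<in> cp1_charts" "c' \<in> cp1_charts" and x: "snd x \<in> fst c" "snd x \<in> fst c'"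
    and A: "has_differential (twistor_lift \<phi>) c c' x A" and p: "p \<in> twistor_fibre k H x"
  shows "d_proj k H c' (\<Phi> p) (L u) = A (d_proj k H c p u)"
proof -
  have p': "p \<in> N_tilde H" "twistor_proj k H p = x" using p by (auto simp: twistor_fibre_def)
  have \<Phi>p: "\<Phi> p \<in> N_tilde H" "snd (twistor_proj k H (\<Phi> p)) \<in> fst c'"
    using p' x by (simp_all add: \<Phi>_N_tilde proj twistor_lift_def)
  obtain S where S: "open S" "p \<in> S" "S \<subseteq> N_tilde H" "\<forall>q\<in>S. snd (twistor_proj k H q) \<in> fst c"
    using differentiable_proj(2)[OF psr p'(1) c(1)] p'(2) x(1) by auto
  have "((z_chart c \<circ> twistor_proj k H) has_derivative d_proj k H c p) (at p)"
    using differentiable_proj(1)[OF psr p'(1) c(1)] p'(2) x(1)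
    unfolding d_proj_def by (simp add: frechet_derivative_works[symmetric])
  moreover have "((z_chart c' \<circ> twistor_lift \<phi> \<circ> z_chart_inv c) has_derivative A) (at ((z_chart c \<circ> twistor_proj k H) p))"
    using A p'(2) by (simp add: has_differential_def)
  ultimately have 1: "((z_chart c' \<circ> twistor_lift \<phi> \<circ> z_chart_inv c) \<circ> (z_chart c \<circ> twistor_proj k H) has_derivative A \<circ> d_proj k H c p) (at p)"
    by (rule diff_chain_at)
  have "((z_chart c' \<circ> twistor_proj k H) has_derivative d_proj k H c' (\<Phi> p)) (at (\<Phi> p))"
    using differentiable_proj(1)[OF psr \<Phi>p(1) c(2) \<Phi>p(2)]
    unfolding d_proj_def by (simp add: frechet_derivative_works[symmetric])
  then have 2: "((z_chart c' \<circ> twistor_proj k H) \<circ> \<Phi> has_derivative d_proj k H c' (\<Phi> p) \<circ> L) (at p)"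
    by (rule diff_chain_at[OF \<Phi>_deriv])
  have "((z_chart c' \<circ> twistor_lift \<phi> \<circ> z_chart_inv c) \<circ> (z_chart c \<circ> twistor_proj k H)) q = ((z_chart c' \<circ> twistor_proj k H) \<circ> \<Phi>) q"
    if "q \<in> S" for q
  proof -
    have "z_chart_inv c (z_chart c (twistor_proj k H q)) = twistor_proj k H q"
      using cp1_chart_inv[OF c(1)] S(4) that by (simp add: z_chart_inv_def z_chart_def prod_eq_iff)
    then show ?thesis using proj[of q] S(3) that by auto
  qed
  then have "((z_chart c' \<circ> twistor_proj k H) \<circ> \<Phi> has_derivative A \<circ> d_proj k H c p) (at p)"
    using has_derivative_transform_within_open[OF 1 S(1,2)] by blast
  from fun_cong[OF has_derivative_unique[OF this 2], of u] show ?thesis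
    by simp
qed

text \<open>Naturality of the exterior derivative. As L is the same at all points, it carries
  constant vector fields to constant ones, so the formula of \<open>ext_deriv\<close> is transported
  term by term; m passes through the derivatives because it is constant.\<close>

lemma ext_deriv_lift:
  assumes p: "p \<in> N_tilde H"
  shows "ext_deriv (lambda_tilde k) (\<Phi> p) (L u) (L v) = of_real m * ext_deriv (lambda_tilde k) p u v"
proof -
  have "frechet_derivative (\<lambda>q. lambda_tilde k q (L v)) (at (\<Phi> p)) (L u)
      = of_real m * frechet_derivative (\<lambda>q. lambda_tilde k q v) (at p) u" for u v
  proof -
    have "((\<lambda>q. lambda_tilde k q (L v)) has_derivative frechet_derivative (\<lambda>q. lambda_tilde k q (L v)) (at (\<Phi> p))) (at (\<Phi> p))"
      using differentiable_lambda_tilde[OF psr, of "\<Phi> p"] p by (simp add: \<Phi>_N_tilde frechet_derivative_works[symmetric])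
    from diff_chain_at[OF \<Phi>_deriv this]
    have 1: "((\<lambda>q. lambda_tilde k (\<Phi> q) (L v)) has_derivative frechet_derivative (\<lambda>q. lambda_tilde k q (L v)) (at (\<Phi> p)) \<circ> L) (at p)"
      by (simp add: comp_def)
    have "((\<lambda>q. lambda_tilde k q v) has_derivative frechet_derivative (\<lambda>q. lambda_tilde k q v) (at p)) (at p)"
      using differentiable_lambda_tilde[OF psr p] by (simp add: frechet_derivative_works[symmetric])
    then have "((\<lambda>q. of_real m * lambda_tilde k q v) has_derivative (\<lambda>u. of_real m * frechet_derivative (\<lambda>q. lambda_tilde k q v) (at p) u)) (at p)"
      by (rule has_derivative_mult_right)
    then have 2: "((\<lambda>q. lambda_tilde k (\<Phi> q) (L v)) has_derivative (\<lambda>u. of_real m * frechet_derivative (\<lambda>q. lambda_tilde k q v) (at p) u)) (at p)"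
      by (rule has_derivative_transform_within_open[OF _ open_N_tilde[OF psr] p]) (simp add: lambda)
    from fun_cong[OF has_derivative_unique[OF 1 2], of u] show ?thesis by simp
  qed
  then show ?thesis by (simp add: ext_deriv_def right_diff_distrib)
qed

lemma holomorphic: "twistor_holomorphic k H (twistor_lift \<phi>)"
  unfolding twistor_holomorphic_def
proof (intro conjI ballI impI)
  show "twistor_lift \<phi> ` twistor_space H \<subseteq> twistor_space H"
    by (auto simp: twistor_lift_def twistor_space_def \<phi>_N_bar)
next
  fix x c c'
  assume c: "c \<in> cp1_charts" "c' \<in> cp1_charts" and x: "snd x \<in> fst c" "snd (twistor_lift \<phi> x) \<in> fst c'"
  have x': "snd x \<in> fst c'" using x(2) by (simp add: twistor_lift_def)
  obtain A where A: "has_differential (twistor_lift \<phi>) c c' x A"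
    using differential[OF c x(1) x'] by blast
  have "(A u', A v') \<in> T01 k H c' (twistor_lift \<phi> x)" if "(u', v') \<in> T01 k H c x" for u' v'
  proof -
    from that obtain p u v where p: "p \<in> twistor_fibre k H x" and uv: "u' = d_proj k H c p u" "v' = d_proj k H c p v"
      and ker: "\<And>y. ext_deriv (lambda_tilde k) p u y + \<i> * ext_deriv (lambda_tilde k) p v y = 0"
      unfolding T01_def by blast
    have "p \<in> N_tilde H" using p by (simp add: twistor_fibre_def)
    note ext = ext_deriv_lift[OF this]
    have "ext_deriv (lambda_tilde k) (\<Phi> p) (L u) y + \<i> * ext_deriv (lambda_tilde k) (\<Phi> p) (L v) y = 0" for y
    proof -
      \<comment> \<open>The kernel condition is tested against all y; surjectivity of L makes each
        of them an image.\<close>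
      obtain y' where y: "y = L y'" using bij(4) by (metis bij_pointE)
      have "ext_deriv (lambda_tilde k) (\<Phi> p) (L u) y + \<i> * ext_deriv (lambda_tilde k) (\<Phi> p) (L v) y
        = of_real m * (ext_deriv (lambda_tilde k) p u y' + \<i> * ext_deriv (lambda_tilde k) p v y')"
        unfolding y ext by (simp add: algebra_simps)
      then show ?thesis by (simp add: ker)
    qed
    moreover have "A u' = d_proj k H c' (\<Phi> p) (L u)" "A v' = d_proj k H c' (\<Phi> p) (L v)"
      by (simp_all add: uv d_proj_lift[OF c x(1) x' A p])
    ultimately show ?thesis
      using p fibre_iff unfolding T01_def by blast
  qed
  with A show "\<exists>A. has_differential (twistor_lift \<phi>) c c' x A \<and>
      (\<forall>(u, v)\<in>T01 k H c x. (A u, A v) \<in> T01 k H c' (twistor_lift \<phi> x))"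
    by blast
qed

text \<open>\<Phi> moves the point of each representing pair and m rescales its value. The
  bijectivity of \<Phi>, L and A shows that no further representatives occur.\<close>

lemma contact_form_lift:
  assumes c: "c \<in> cp1_charts" "c' \<in> cp1_charts" and x: "snd x \<in> fst c" "snd x \<in> fst c'"
    and A: "has_differential (twistor_lift \<phi>) c c' x A" "bij A"
  shows "contact_form k H c' (twistor_lift \<phi> x) (A v)
    = (\<lambda>(p, y). (\<Phi> p, of_real m * y)) ` contact_form k H c x v"
proof (intro equalityI subsetI)
  fix q assume "q \<in> contact_form k H c' (twistor_lift \<phi> x) (A v)"
  then obtain p' u' where q: "q = (p', lambda_tilde k p' u')" "p' \<in> twistor_fibre k H (twistor_lift \<phi> x)"
    "d_proj k H c' p' u' = A v"
    unfolding contact_form_def by blast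
  obtain p u where pu: "p' = \<Phi> p" "u' = L u" using bij(3,4) by (metis bij_pointE)
  have p: "p \<in> twistor_fibre k H x" using q(2) by (simp add: pu fibre_iff)
  then have "p \<in> N_tilde H" by (simp add: twistor_fibre_def)
  then have "q = (\<lambda>(p, y). (\<Phi> p, of_real m * y)) (p, lambda_tilde k p u)"
    by (simp add: q(1) pu lambda)
  moreover have "d_proj k H c p u = v"
    using q(3) d_proj_lift[OF c x A(1) p] A(2) by (simp add: pu bij_def inj_eq)
  then have "(p, lambda_tilde k p u) \<in> contact_form k H c x v"
    using p unfolding contact_form_def by blast
  ultimately show "q \<in> (\<lambda>(p, y). (\<Phi> p, of_real m * y)) ` contact_form k H c x v"
    by (rule image_eqI)
next
  fix q assume "q \<in> (\<lambda>(p, y). (\<Phi> p, of_real m * y)) ` contact_form k H c x v"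
  then obtain y where y: "y \<in> contact_form k H c x v" "q = (\<lambda>(p, y). (\<Phi> p, of_real m * y)) y"
    by blast
  from y(1) obtain p u where pu: "y = (p, lambda_tilde k p u)" and p: "p \<in> twistor_fibre k H x"
    and u: "d_proj k H c p u = v"
    unfolding contact_form_def by blast
  have q: "q = (\<Phi> p, of_real m * lambda_tilde k p u)"
    by (simp add: y(2) pu)
  have "p \<in> N_tilde H" using p by (simp add: twistor_fibre_def)
  then have "q = (\<Phi> p, lambda_tilde k (\<Phi> p) (L u))" by (simp add: q lambda)
  moreover have "d_proj k H c' (\<Phi> p) (L u) = A v"
    by (simp add: d_proj_lift[OF c x A(1) p] u)
  ultimately show "q \<in> contact_form k H c' (twistor_lift \<phi> x) (A v)"
    using p fibre_iff unfolding contact_form_def by blast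
qed

lemma contact: "preserves_contact_distribution k H (twistor_lift \<phi>)"
  unfolding preserves_contact_distribution_def
proof (intro ballI impI)
  fix x c c'
  assume c: "c \<in> cp1_charts" "c' \<in> cp1_charts" and x: "snd x \<in> fst c" "snd (twistor_lift \<phi> x) \<in> fst c'"
  have x': "snd x \<in> fst c'" using x(2) by (simp add: twistor_lift_def)
  obtain A where A: "has_differential (twistor_lift \<phi>) c c' x A" "bij A"
    using differential[OF c x(1) x'] by blast
  let ?f = "\<lambda>(p, y). (\<Phi> p, of_real m * y :: complex)"
  have "inj ?f" using bij(3) m by (auto simp: inj_on_def bij_def)
  have fibre: "twistor_fibre k H (twistor_lift \<phi> x) = \<Phi> ` twistor_fibre k H x"
    by (rule bij_image_eqI[OF bij(3) fibre_iff, symmetric])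
  \<comment> \<open>The zero element over x goes to the zero element over its image. As
    \<open>?f\<close> is injective, because m is nonzero, the vanishing of the contact form is
    preserved in both directions.\<close>
  have "twistor_fibre k H (twistor_lift \<phi> x) \<times> {0} = ?f ` (twistor_fibre k H x \<times> {0})"
    by (simp add: fibre image_paired_Times[of \<Phi> "\<lambda>y. of_real m * y" "twistor_fibre k H x" "{0}", simplified])
  then have iff: "A v \<in> contact_distribution k H c' (twistor_lift \<phi> x) \<longleftrightarrow> v \<in> contact_distribution k H c x" for v
    unfolding contact_distribution_def mem_Collect_eq contact_form_lift[OF c x(1) x' A]
    using inj_image_eq_iff[OF \<open>inj ?f\<close>] by simp
  have "A ` contact_distribution k H c x = contact_distribution k H c' (twistor_lift \<phi> x)"
    by (rule bij_image_eqI[OF A(2) iff])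
  with A show "\<exists>A. has_differential (twistor_lift \<phi>) c c' x A \<and>
      A ` contact_distribution k H c x = contact_distribution k H c' (twistor_lift \<phi> x)"
    by blast
qed

end

theorem proposition4p15:
  fixes k :: "'n::finite \<Rightarrow> 'n \<Rightarrow> 'n \<Rightarrow> real"
    and H :: "(real^'n) set"
    and N :: "'n q_point set"
    and g :: "'n q_point \<Rightarrow> 'n q_point \<Rightarrow> 'n q_point \<Rightarrow> real"
  assumes "tree_level_q_map_space k H N g"
  shows "(\<forall>\<phi>\<in>L_group k.
            twistor_holomorphic k H (twistor_lift \<phi>) \<and>
            preserves_contact_distribution k H (twistor_lift \<phi>) \<and>
            (\<forall>x\<in>twistor_space H.
               twistor_lift \<phi> (real_structure x) = real_structure (twistor_lift \<phi> x))) \<and>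
         (\<forall>w\<in>L_words. \<forall>p\<in>N. \<forall>t. t \<noteq> 0 \<longrightarrow>
            darboux k (twistor_lift (word_act k w) (p, Fin t)) =
              word_rule k w (darboux k (p, Fin t)))"
proof -
  have psr: "psr_manifold k H" and N: "N = N_bar H"
    using assms by (simp_all add: tree_level_q_map_space_def)
  have "twistor_holomorphic k H (twistor_lift \<phi>) \<and> preserves_contact_distribution k H (twistor_lift \<phi>)"
    if "\<phi> \<in> L_group k" for \<phi>
  proof -
    obtain w where w: "w \<in> L_words" "\<phi> = word_act k w"
      using \<open>\<phi> \<in> L_group k\<close> by (auto simp: L_group_def)
    obtain D \<Phi> L m where "contact_lift k H \<phi> D \<Phi> L m"
      using contact_lift_word[OF psr w(1)] w(2) by blast
    then show ?thesis
      by (intro conjI contact_lift.holomorphic contact_lift.contact)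
  qed
  \<comment> \<open>The two maps act on different factors of the product.\<close>
  moreover have "twistor_lift \<phi> (real_structure x) = real_structure (twistor_lift \<phi> x)"
    for \<phi> :: "'n q_point \<Rightarrow> 'n q_point" and x
    by (simp add: twistor_lift_def real_structure_def prod.map_comp comp_def)
  ultimately show ?thesis
    using darboux_word_act[OF psr] N by blast
qed

end
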